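(* Up to isomorphism (of Lie $\mathfrak{sl}_2$-algebras), the minimal solvable Lie $\mathfrak{sl}_2$-algebras are $\mathfrak{v}_n$ and $\mathfrak{h}_{2n-1}$, for $n\ge 2$.
   Context: All Lie algebras are finite-dimensional over a field $K$ of characteristic zero; $\mathfrak{sl}_2=\mathfrak{sl}_2(K)$. For a Lie algebra $\mathfrak{s}$, a Lie $\mathfrak{s}$-algebra is a Lie algebra $\mathfrak{n}$ endowed with a Lie algebra morphism $\mathfrak{s}\to\mathrm{Der}(\mathfrak{n})$ such that the resulting action of $\mathfrak{s}$ on $\mathfrak{n}$, written $(s,n)\mapsto [s,n]$, is completely reducible. $[\mathfrak{s},\mathfrak{n}]$ is the Lie subalgebra generated by the brackets $[s,n]$. It is minimal if $[\mathfrak{s},\mathfrak{n}]\ne0$ and for every $\mathfrak{s}$-stable Lie subalgebra $\mathfrak{n}'$ of $\mathfrak{n}$, either $\mathfrak{n}'=\mathfrak{n}$ or $[\mathfrak{s},\mathfrak{n}']=0$. For $n\ge1$, $\mathfrak{v}_n$ denotes the irreducible $\mathfrak{sl}_2$-module of dimension $n$ (unique up to isomorphism), viewed as an abelian Lie $\mathfrak{sl}_2$-algebra. For $m\ge1$, $\mathfrak{h}_{2m+1}$ denotes the $(2m+1)$-dimensional Heisenberg Lie algebra $\mathfrak{v}_{2m}\oplus K$ with bracket $[(x,a),(y,b)]=(0,\varphi(x,y))$, where $\varphi$ is a nonzero $\mathfrak{sl}_2$-invariant alternating bilinear form on $\mathfrak{v}_{2m}$ (unique up to scalar), endowed with the $\mathfrak{sl}_2$-action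 $[s,(x,a)]=([s,x],0)$. *)

theory Defs
  imports "HOL-Analysis.Determinants" "HOL-Library.Function_Algebras"
begin

text \<open>
  An algebraic structure over the field \<open>'k\<close> lives on a carrier that is a linear subspace of
  the whole type \<open>'a\<close>, which itself is a vector space under \<open>scale\<close>. Operations are only
  constrained on the carrier.
\<close>

record ('k, 'a) vspace =
  carrier :: "'a set"
  scale :: "'k \<Rightarrow> 'a \<Rightarrow> 'a"

record ('k, 'a) lie_alg = "('k, 'a) vspace" +
  brk :: "'a \<Rightarrow> 'a \<Rightarrow> 'a"

record ('k, 's, 'a) lie_s_alg = "('k, 'a) lie_alg" +
  act :: "'s \<Rightarrow> 'a \<Rightarrow> 'a"

definition subspace_of :: "('k::field, 'a::ab_group_add, 'm) vspace_scheme \<Rightarrow> 'a set \<Rightarrow> bool" where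
  "subspace_of V W \<longleftrightarrow> module.subspace (scale V) W \<and> W \<subseteq> carrier V"

definition fin_dim_space :: "('k::field, 'a::ab_group_add, 'm) vspace_scheme \<Rightarrow> bool" where
  "fin_dim_space V \<longleftrightarrow>
     vector_space (scale V) \<and> (\<exists>B. finite B \<and> module.span (scale V) B = carrier V)"

definition linear_between ::
  "('k::field, 'a::ab_group_add, 'm) vspace_scheme \<Rightarrow> ('k, 'b::ab_group_add, 'n) vspace_scheme
    \<Rightarrow> ('a \<Rightarrow> 'b) \<Rightarrow> bool" where
  "linear_between V W f \<longleftrightarrow>
     (\<forall>x\<in>carrier V. f x \<in> carrier W) \<and>
     (\<forall>x\<in>carrier V. \<forall>y\<in>carrier V. f (x + y) = f x + f y) \<and>
     (\<forall>c. \<forall>x\<in>carrier V. f (scale V c x) = scale W c (f x))"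


subsection \<open>Lie algebras\<close>

definition lie_algebra :: "('k::field, 'a::ab_group_add, 'm) lie_alg_scheme \<Rightarrow> bool" where
  "lie_algebra L \<longleftrightarrow>
     fin_dim_space L \<and>
     (\<forall>x\<in>carrier L. linear_between L L (brk L x)) \<and>
     (\<forall>y\<in>carrier L. linear_between L L (\<lambda>x. brk L x y)) \<and>
     (\<forall>x\<in>carrier L. brk L x x = 0) \<and>
     (\<forall>x\<in>carrier L. \<forall>y\<in>carrier L. \<forall>z\<in>carrier L.
        brk L x (brk L y z) + brk L y (brk L z x) + brk L z (brk L x y) = 0)"

definition lie_subalgebra :: "('k::field, 'a::ab_group_add, 'm) lie_alg_scheme \<Rightarrow> 'a set \<Rightarrow> bool" where
  "lie_subalgebra L M \<longleftrightarrow> subspace_of L M \<and> (\<forall>x\<in>M. \<forall>y\<in>M. brk L x y \<in> M)"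

definition generated_subalgebra ::
  "('k::field, 'a::ab_group_add, 'm) lie_alg_scheme \<Rightarrow> 'a set \<Rightarrow> 'a set" where
  "generated_subalgebra L X = \<Inter>{M. lie_subalgebra L M \<and> X \<subseteq> M}"

fun derived_series :: "('k::field, 'a::ab_group_add, 'm) lie_alg_scheme \<Rightarrow> nat \<Rightarrow> 'a set" where
  "derived_series L 0 = carrier L"
| "derived_series L (Suc i) =
     module.span (scale L) {brk L x y |x y. x \<in> derived_series L i \<and> y \<in> derived_series L i}"

definition solvable :: "('k::field, 'a::ab_group_add, 'm) lie_alg_scheme \<Rightarrow> bool" where
  "solvable L \<longleftrightarrow> (\<exists>i. derived_series L i = {0})"

definition derivation ::
  "('k::field, 'a::ab_group_add, 'm) lie_alg_scheme \<Rightarrow> ('a \<Rightarrow> 'a) \<Rightarrow> bool" where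
  "derivation L D \<longleftrightarrow>
     linear_between L L D \<and>
     (\<forall>x\<in>carrier L. \<forall>y\<in>carrier L. D (brk L x y) = brk L (D x) y + brk L x (D y))"


subsection \<open>Modules over a Lie algebra\<close>

definition lie_module ::
  "('k::field, 's::ab_group_add, 'm) lie_alg_scheme \<Rightarrow> ('k, 'a::ab_group_add, 'n) vspace_scheme
    \<Rightarrow> ('s \<Rightarrow> 'a \<Rightarrow> 'a) \<Rightarrow> bool" where
  "lie_module S V \<rho> \<longleftrightarrow>
     lie_algebra S \<and> fin_dim_space V \<and>
     (\<forall>s\<in>carrier S. linear_between V V (\<rho> s)) \<and>
     (\<forall>x\<in>carrier V. linear_between S V (\<lambda>s. \<rho> s x)) \<and>
     (\<forall>s\<in>carrier S. \<forall>t\<in>carrier S. \<forall>x\<in>carrier V.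
        \<rho> (brk S s t) x = \<rho> s (\<rho> t x) - \<rho> t (\<rho> s x))"

definition stable ::
  "('k, 's, 'm) lie_alg_scheme \<Rightarrow> ('s \<Rightarrow> 'a \<Rightarrow> 'a) \<Rightarrow> 'a set \<Rightarrow> bool" where
  "stable S \<rho> W \<longleftrightarrow> (\<forall>s\<in>carrier S. \<forall>x\<in>W. \<rho> s x \<in> W)"

definition irreducible_module ::
  "('k::field, 's::ab_group_add, 'm) lie_alg_scheme \<Rightarrow> ('k, 'a::ab_group_add, 'n) vspace_scheme
    \<Rightarrow> ('s \<Rightarrow> 'a \<Rightarrow> 'a) \<Rightarrow> bool" where
  "irreducible_module S V \<rho> \<longleftrightarrow>
     lie_module S V \<rho> \<and> carrier V \<noteq> {0} \<and>
     (\<forall>W. subspace_of V W \<and> stable S \<rho> W \<longrightarrow> W = {0} \<or> W = carrier V)"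

definition completely_reducible ::
  "('k::field, 's::ab_group_add, 'm) lie_alg_scheme \<Rightarrow> ('k, 'a::ab_group_add, 'n) vspace_scheme
    \<Rightarrow> ('s \<Rightarrow> 'a \<Rightarrow> 'a) \<Rightarrow> bool" where
  "completely_reducible S V \<rho> \<longleftrightarrow>
     (\<forall>W. subspace_of V W \<and> stable S \<rho> W \<longrightarrow>
        (\<exists>W'. subspace_of V W' \<and> stable S \<rho> W' \<and>
              W \<inter> W' = {0} \<and> {w + w' |w w'. w \<in> W \<and> w' \<in> W'} = carrier V))"


subsection \<open>Lie algebras acted upon by a Lie algebra\<close>

definition lie_s_algebra ::
  "('k::field, 's::ab_group_add, 'm) lie_alg_scheme
    \<Rightarrow> ('k, 's, 'a::ab_group_add, 'n) lie_s_alg_scheme \<Rightarrow> bool" where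
  "lie_s_algebra S N \<longleftrightarrow>
     lie_algebra N \<and> lie_module S N (act N) \<and>
     (\<forall>s\<in>carrier S. derivation N (act N s)) \<and>
     completely_reducible S N (act N)"

text \<open>For an \<open>S\<close>-stable subalgebra \<open>M\<close> of \<open>N\<close>, this is \<open>[S, M]\<close>.\<close>

definition act_subalgebra ::
  "('k::field, 's::ab_group_add, 'm) lie_alg_scheme
    \<Rightarrow> ('k, 's, 'a::ab_group_add, 'n) lie_s_alg_scheme \<Rightarrow> 'a set \<Rightarrow> 'a set" where
  "act_subalgebra S N M = generated_subalgebra N {act N s x |s x. s \<in> carrier S \<and> x \<in> M}"

definition minimal_lie_s_algebra ::
  "('k::field, 's::ab_group_add, 'm) lie_alg_scheme
    \<Rightarrow> ('k, 's, 'a::ab_group_add, 'n) lie_s_alg_scheme \<Rightarrow> bool" where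
  "minimal_lie_s_algebra S N \<longleftrightarrow>
     lie_s_algebra S N \<and> act_subalgebra S N (carrier N) \<noteq> {0} \<and>
     (\<forall>M. lie_subalgebra N M \<and> stable S (act N) M \<longrightarrow>
        M = carrier N \<or> act_subalgebra S N M = {0})"

definition lie_s_isomorphic ::
  "('k::field, 's::ab_group_add, 'm) lie_alg_scheme
    \<Rightarrow> ('k, 's, 'a::ab_group_add, 'n) lie_s_alg_scheme
    \<Rightarrow> ('k, 's, 'b::ab_group_add, 'p) lie_s_alg_scheme \<Rightarrow> bool" where
  "lie_s_isomorphic S N N' \<longleftrightarrow>
     (\<exists>f. bij_betw f (carrier N) (carrier N') \<and> linear_between N N' f \<and>
        (\<forall>x\<in>carrier N. \<forall>y\<in>carrier N. f (brk N x y) = brk N' (f x) (f y)) \<and>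
        (\<forall>s\<in>carrier S. \<forall>x\<in>carrier N. f (act N s x) = act N' s (f x)))"


subsection \<open>The Lie algebra of traceless two-by-two matrices\<close>

definition sl2 :: "('k::field_char_0, 'k ^ 2 ^ 2) lie_alg" where
  "sl2 = \<lparr>carrier = {A. trace A = 0},
          scale = (\<lambda>c A. \<chi> i j. c * A $ i $ j),
          brk = (\<lambda>A B. A ** B - B ** A)\<rparr>"


subsection \<open>Irreducible modules and Heisenberg algebras\<close>

text \<open>The space \<open>K\<^sup>n\<close>, as the sequences vanishing from index \<open>n\<close> on.\<close>

definition coord_space :: "nat \<Rightarrow> ('k::field, nat \<Rightarrow> 'k) vspace" where
  "coord_space n = \<lparr>carrier = {x. \<forall>i\<ge>n. x i = 0}, scale = (\<lambda>c x i. c * x i)\<rparr>"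

text \<open>
  The irreducible \<open>sl2\<close>-module of dimension \<open>n\<close> exists for \<open>n \<ge> 1\<close> and is unique up to isomorphism,
  so one is chosen among the irreducible module structures on \<open>K\<^sup>n\<close>. Likewise the form in the
  definition of the Heisenberg algebra is unique up to a nonzero scalar.
\<close>

definition irr_act :: "nat \<Rightarrow> 'k::field_char_0 ^ 2 ^ 2 \<Rightarrow> (nat \<Rightarrow> 'k) \<Rightarrow> (nat \<Rightarrow> 'k)" where
  "irr_act n = (SOME \<rho>. irreducible_module sl2 (coord_space n) \<rho>)"

definition irr_alg :: "nat \<Rightarrow> ('k::field_char_0, 'k ^ 2 ^ 2, nat \<Rightarrow> 'k) lie_s_alg" where
  "irr_alg n = \<lparr>carrier = carrier (coord_space n), scale = scale (coord_space n),
                brk = (\<lambda>x y. 0), act = irr_act n\<rparr>"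

definition alternating_form ::
  "('k::field, 'a::ab_group_add, 'm) vspace_scheme \<Rightarrow> ('a \<Rightarrow> 'a \<Rightarrow> 'k) \<Rightarrow> bool" where
  "alternating_form V \<phi> \<longleftrightarrow>
     (\<forall>x\<in>carrier V. linear_between V \<lparr>carrier = UNIV, scale = (*)\<rparr> (\<phi> x)) \<and>
     (\<forall>y\<in>carrier V. linear_between V \<lparr>carrier = UNIV, scale = (*)\<rparr> (\<lambda>x. \<phi> x y)) \<and>
     (\<forall>x\<in>carrier V. \<phi> x x = 0)"

definition invariant_form ::
  "('k, 's, 'm) lie_alg_scheme \<Rightarrow> ('k::field, 's, 'a, 'n) lie_s_alg_scheme
    \<Rightarrow> ('a \<Rightarrow> 'a \<Rightarrow> 'k) \<Rightarrow> bool" where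
  "invariant_form S V \<phi> \<longleftrightarrow>
     (\<forall>s\<in>carrier S. \<forall>x\<in>carrier V. \<forall>y\<in>carrier V. \<phi> (act V s x) y + \<phi> x (act V s y) = 0)"

definition heis_form :: "nat \<Rightarrow> (nat \<Rightarrow> 'k::field_char_0) \<Rightarrow> (nat \<Rightarrow> 'k) \<Rightarrow> 'k" where
  "heis_form m = (SOME \<phi>. alternating_form (irr_alg (2 * m)) \<phi> \<and>
                          invariant_form sl2 (irr_alg (2 * m)) \<phi> \<and>
                          (\<exists>x\<in>carrier (irr_alg (2 * m)). \<exists>y\<in>carrier (irr_alg (2 * m)). \<phi> x y \<noteq> 0))"

text \<open>\<open>heis_alg m\<close> has dimension \<open>2 * m + 1\<close>.\<close>

definition heis_alg :: "nat \<Rightarrow> ('k::field_char_0, 'k ^ 2 ^ 2, (nat \<Rightarrow> 'k) \<times> 'k) lie_s_alg" where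
  "heis_alg m =
     \<lparr>carrier = carrier (irr_alg (2 * m)) \<times> UNIV,
      scale = (\<lambda>c (x, a). (scale (irr_alg (2 * m)) c x, c * a)),
      brk = (\<lambda>(x, a) (y, b). (0, heis_form m x y)),
      act = (\<lambda>s (x, a). (act (irr_alg (2 * m)) s x, 0))\<rparr>"

end

theory Submission
  imports Defs "HOL-Computational_Algebra.Polynomial"
begin

text \<open>
  Everything rests on the fact that, over any field of characteristic zero, a nonzero
  finite-dimensional \<open>sl2\<close>-module contains a vector killed by \<open>E\<close> that is an eigenvector of \<open>H\<close>;
  its images under the powers of \<open>F\<close> form a string on which the action is given by universal
  formulas in the length \<open>n\<close> of the string (\<open>exists_hw_string\<close>, \<open>act_comb\<close>). Since the field need not be
  algebraically closed, no eigenvalue is available for free: \<open>E\<close> and \<open>F\<close> are shown to be nilpotent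
  by looking at their minimal polynomials, and the eigenvector is then found by a descent on the
  nilpotency order of \<open>F\<close>.

  The string formulas give uniqueness of the irreducible module of each dimension, and they show
  that an invariant bilinear map with values in a space on which \<open>sl2\<close> acts trivially is determined
  by its value on the two ends of the string: it is a fixed alternating sum over the coordinates
  times that value (\<open>invariant_form_eq_string_form\<close>). Antisymmetry forces \<open>n\<close> to be even when the
  map is nonzero.

  Now let \<open>N\<close> be minimal and solvable. Its derived subalgebra \<open>D\<close> is proper and stable, so \<open>sl2\<close> acts
  trivially on it. Complete reducibility provides a string of length at least two outside the
  invariants; its span \<open>U\<close> consists of commutators \<open>[s, u]\<close>. For \<open>d\<close> in \<open>D\<close> the derivation rule
  gives \<open>[d, [s, u]] = [s, [d, u]] - [[s, d], u] = 0\<close>, because \<open>[d, u]\<close> and \<open>d\<close> both lie in \<open>D\<close>; hence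
  \<open>D\<close> centralises \<open>U\<close>. The bracket of \<open>U\<close> with itself is an invariant map into \<open>D\<close>, so all its values
  are multiples of a single vector \<open>z\<close>. Thus \<open>U\<close> and \<open>z\<close> span a stable subalgebra with nontrivial
  action, which by minimality is all of \<open>N\<close> (\<open>minimal_solvable_structure\<close>). If \<open>z\<close> vanishes, \<open>N\<close> is the abelian
  algebra on an irreducible module, and otherwise it is a Heisenberg algebra.

  Conversely, the two families are minimal because a stable subspace of an irreducible module is
  trivial, and a stable subspace of a Heisenberg algebra either lies in the centre or contains the
  whole complement of the centre, whose brackets produce the centre.
\<close>

section \<open>Linear independence and annihilating polynomials\<close>

locale fd_space =
  fixes V :: "('k::field, 'a::ab_group_add, 'm) vspace_scheme"
  assumes fin_dim: "fin_dim_space V"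
begin

sublocale vector_space "scale V"
  using fin_dim by (simp add: fin_dim_space_def)

lemma subspace_carrier: "subspace (carrier V)"
  using fin_dim subspace_span by (metis fin_dim_space_def)

lemma carrier_zero [simp]: "0 \<in> carrier V"
  and carrier_add [simp]: "x \<in> carrier V \<Longrightarrow> y \<in> carrier V \<Longrightarrow> x + y \<in> carrier V"
  and carrier_scale [simp]: "x \<in> carrier V \<Longrightarrow> scale V c x \<in> carrier V"
  and carrier_diff [simp]: "x \<in> carrier V \<Longrightarrow> y \<in> carrier V \<Longrightarrow> x - y \<in> carrier V"
  and carrier_minus [simp]: "x \<in> carrier V \<Longrightarrow> - x \<in> carrier V"
  by (simp_all add: subspace_0 subspace_add subspace_scale subspace_diff subspace_neg subspace_carrier)

lemma carrier_sum [simp]: "(\<And>i. i \<in> A \<Longrightarrow> f i \<in> carrier V) \<Longrightarrow> sum f A \<in> carrier V"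
  by (rule subspace_sum[OF subspace_carrier])

text \<open>
  Independence of a sequence rather than of a set of vectors: repeated entries count as a relation,
  so that the powers of an operator applied to a vector can be treated without case distinctions.
\<close>

definition seq_indep :: "nat \<Rightarrow> (nat \<Rightarrow> 'a) \<Rightarrow> bool" where
  "seq_indep n w \<longleftrightarrow> (\<forall>c. (\<Sum>i<n. scale V (c i) (w i)) = 0 \<longrightarrow> (\<forall>i<n. c i = 0))"

lemma seq_indep_le_card:
  assumes "seq_indep n w" "finite B" "\<And>i. i < n \<Longrightarrow> w i \<in> span B"
  shows "n \<le> card B"
proof -
  have inj: "inj_on w {..<n}"
  proof (rule inj_onI, rule ccontr)
    fix i j assume *: "i \<in> {..<n}" "j \<in> {..<n}" "w i = w j" "i \<noteq> j"
    let ?c = "\<lambda>k. (if k = i then 1 else 0) - (if k = j then 1 else 0) :: 'k"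
    have "(\<Sum>k<n. scale V (?c k) (w k))
        = (\<Sum>k<n. if k = i then w k else 0) - (\<Sum>k<n. if k = j then w k else 0)"
      unfolding sum_subtractf[symmetric] by (rule sum.cong) (auto simp: scale_left_diff_distrib)
    also have "\<dots> = 0" using * by simp
    finally have "\<forall>k<n. ?c k = 0"
      using assms(1)[unfolded seq_indep_def, rule_format, of ?c] by blast
    then have "?c i = 0" using * by blast
    then show False using * by simp
  qed
  have "independent (w ` {..<n})"
    unfolding dependent_finite[OF finite_imageI[OF finite_lessThan]]
  proof (safe, goal_cases)
    case (1 u x i)
    then have "(\<Sum>i<n. scale V (u (w i)) (w i)) = 0"
      by (simp add: sum.reindex[OF inj] o_def)
    then have "u (w i) = 0"
      using assms(1)[unfolded seq_indep_def, rule_format, of "\<lambda>i. u (w i)"] \<open>i < n\<close> by blast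
    then show False using 1 by simp
  qed
  from independent_span_bound[OF assms(2) this] assms(3)
  have "card (w ` {..<n}) \<le> card B" by auto
  then show ?thesis by (simp add: card_image[OF inj])
qed

text \<open>
  An independent sequence that is as long as a spanning set spans as well, since appending any
  further vector creates a relation in which that vector occurs.
\<close>

lemma seq_indep_imp_span:
  assumes "seq_indep n w" "\<And>i. i < n \<Longrightarrow> w i \<in> span B" "finite B" "card B \<le> n" "x \<in> span B"
  shows "\<exists>c. x = (\<Sum>i<n. scale V (c i) (w i))"
proof -
  let ?w = "w(n := x)"
  have "\<not> seq_indep (Suc n) ?w"
  proof
    assume "seq_indep (Suc n) ?w"
    moreover have "?w i \<in> span B" if "i < Suc n" for i
      using that assms by (auto simp: less_Suc_eq)
    ultimately show False using seq_indep_le_card[of "Suc n" ?w B] assms by simp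
  qed
  then obtain c where c: "(\<Sum>i<Suc n. scale V (c i) (?w i)) = 0" and nz: "\<exists>i<Suc n. c i \<noteq> 0"
    unfolding seq_indep_def by blast
  have s: "(\<Sum>i<n. scale V (c i) (w i)) + scale V (c n) x = 0" using c by simp
  have cn: "c n \<noteq> 0"
  proof
    assume "c n = 0"
    with s have "(\<Sum>i<n. scale V (c i) (w i)) = 0" by simp
    with assms(1) have "\<forall>i<n. c i = 0" unfolding seq_indep_def by blast
    with nz \<open>c n = 0\<close> show False by (auto simp: less_Suc_eq)
  qed
  have "scale V (c n) x = scale V (-1) (\<Sum>i<n. scale V (c i) (w i))"
    using s by (simp add: add_eq_0_iff)
  then have "scale V (inverse (c n)) (scale V (c n) x)
    = scale V (inverse (c n)) (scale V (-1) (\<Sum>i<n. scale V (c i) (w i)))" by simp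
  then have "x = (\<Sum>i<n. scale V (- (inverse (c n) * c i)) (w i))"
    using cn by (simp add: scale_sum_right flip: sum_negf)
  then show ?thesis by (intro exI[of _ "\<lambda>i. - (inverse (c n) * c i)"])
qed

lemma fin_dim_subspace:
  assumes "subspace W" "W \<subseteq> carrier V"
  shows "fin_dim_space (V\<lparr>carrier := W\<rparr>)"
proof -
  obtain B where B: "B \<subseteq> W" "independent B" "W \<subseteq> span B"
    using maximal_independent_subset by blast
  obtain C where C: "finite C" "span C = carrier V"
    using fin_dim by (auto simp: fin_dim_space_def)
  have "finite B"
    using independent_span_bound[OF C(1) B(2)] B(1) assms C by blast
  moreover have "span B = W" using B assms(1) span_minimal by blast
  ultimately show ?thesis
    using vector_space_axioms by (auto simp: fin_dim_space_def)
qed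

text \<open>
  The operator \<open>p(T)\<close>, evaluated by Horner's scheme. Only the values of \<open>T\<close> on the carrier are
  meaningful, so the polynomial calculus below is restricted to vectors of the carrier.
\<close>

definition op_poly :: "('a \<Rightarrow> 'a) \<Rightarrow> 'k poly \<Rightarrow> 'a \<Rightarrow> 'a" where
  "op_poly T p v = fold_coeffs (\<lambda>a u. scale V a v + T u) p 0"

end

locale fd_op = fd_space V for V :: "('k::field, 'a::ab_group_add, 'm) vspace_scheme" +
  fixes T :: "'a \<Rightarrow> 'a"
  assumes lin: "linear_between V V T"
begin

lemma T_carrier [simp]: "x \<in> carrier V \<Longrightarrow> T x \<in> carrier V"
  and T_add: "x \<in> carrier V \<Longrightarrow> y \<in> carrier V \<Longrightarrow> T (x + y) = T x + T y"
  and T_scale: "x \<in> carrier V \<Longrightarrow> T (scale V c x) = scale V c (T x)"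
  using lin by (auto simp: linear_between_def)

lemma T_zero [simp]: "T 0 = 0"
  using T_scale[of 0 0] by simp

lemma T_diff: "x \<in> carrier V \<Longrightarrow> y \<in> carrier V \<Longrightarrow> T (x - y) = T x - T y"
  using T_add[of x "scale V (-1) y"] T_scale[of y "-1"] by simp

lemma op_poly_0 [simp]: "op_poly T 0 v = 0"
  by (simp add: op_poly_def)

lemma op_poly_pCons [simp]: "op_poly T (pCons a p) v = scale V a v + T (op_poly T p v)"
  by (cases "p = 0 \<and> a = 0") (auto simp: op_poly_def)

lemma op_poly_carrier [simp]: "v \<in> carrier V \<Longrightarrow> op_poly T p v \<in> carrier V"
  by (induction p) auto

lemma op_poly_plus: "v \<in> carrier V \<Longrightarrow> op_poly T (p + q) v = op_poly T p v + op_poly T q v"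
  by (induction p q rule: poly_induct2) (auto simp: T_add scale_left_distrib algebra_simps)

lemma op_poly_smult: "v \<in> carrier V \<Longrightarrow> op_poly T (smult c p) v = scale V c (op_poly T p v)"
  by (induction p) (auto simp: T_scale scale_right_distrib)

lemma op_poly_minus:
  assumes "v \<in> carrier V" shows "op_poly T (p - q) v = op_poly T p v - op_poly T q v"
  using op_poly_plus[OF assms, of "p - q" q] by (simp add: algebra_simps)

lemma op_poly_mult: "v \<in> carrier V \<Longrightarrow> op_poly T (p * q) v = op_poly T p (op_poly T q v)"
  by (induction p) (auto simp: op_poly_plus op_poly_smult)

lemma op_poly_zero [simp]: "op_poly T p 0 = 0"
  by (induction p) auto

lemma op_poly_add:
  "x \<in> carrier V \<Longrightarrow> y \<in> carrier V \<Longrightarrow> op_poly T p (x + y) = op_poly T p x + op_poly T p y"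
  by (induction p) (auto simp: T_add scale_right_distrib algebra_simps)

lemma op_poly_scale:
  "x \<in> carrier V \<Longrightarrow> op_poly T p (scale V c x) = scale V c (op_poly T p x)"
  by (induction p) (auto simp: T_scale scale_right_distrib mult.commute)

lemma op_poly_sum:
  "v \<in> carrier V \<Longrightarrow> op_poly T (sum p A) v = (\<Sum>i\<in>A. op_poly T (p i) v)"
  by (induction A rule: infinite_finite_induct) (auto simp: op_poly_plus)

lemma op_poly_monom: "v \<in> carrier V \<Longrightarrow> op_poly T (monom c k) v = scale V c ((T ^^ k) v)"
proof (induction k)
  case (Suc k)
  have "(T ^^ k) v \<in> carrier V" using Suc.prems by (induction k) auto
  then show ?case using Suc by (simp add: monom_Suc T_scale)
qed (simp add: monom_0)

text \<open>
  For a single vector \<open>v\<close> a polynomial comes from a relation between the vectors \<open>T\<^sup>i v\<close>; products of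
  such polynomials then handle a finite spanning set one vector at a time.
\<close>

lemma exists_annihilating_poly: "\<exists>p. p \<noteq> 0 \<and> (\<forall>v\<in>carrier V. op_poly T p v = 0)"
proof -
  obtain C where C: "finite C" "span C = carrier V"
    using fin_dim by (auto simp: fin_dim_space_def)
  have single: "\<exists>p. p \<noteq> 0 \<and> op_poly T p v = 0" if v: "v \<in> carrier V" for v
  proof -
    have pow: "(T ^^ i) v \<in> carrier V" for i using v by (induction i) auto
    have "\<not> seq_indep (Suc (card C)) (\<lambda>i. (T ^^ i) v)"
      using seq_indep_le_card[of "Suc (card C)" "\<lambda>i. (T ^^ i) v" C] C pow by auto
    then obtain c j where c: "(\<Sum>i<Suc (card C). scale V (c i) ((T ^^ i) v)) = 0"
      and j: "j < Suc (card C)" "c j \<noteq> 0"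
      unfolding seq_indep_def by blast
    let ?p = "\<Sum>i<Suc (card C). monom (c i) i"
    have "coeff ?p j = c j"
      using j by (simp add: coeff_sum sum.delta del: sum.lessThan_Suc)
    then have "?p \<noteq> 0" using j by (metis coeff_0)
    moreover have "op_poly T ?p v = 0"
      using v c by (simp add: op_poly_sum op_poly_monom del: sum.lessThan_Suc)
    ultimately show ?thesis by blast
  qed
  have "\<exists>p. p \<noteq> 0 \<and> (\<forall>v\<in>F. op_poly T p v = 0)" if "finite F" "F \<subseteq> carrier V" for F
    using that
  proof (induction F rule: finite_induct)
    case empty
    show ?case by (intro exI[of _ 1]) auto
  next
    case (insert b F)
    then obtain p where p: "p \<noteq> 0" "\<forall>v\<in>F. op_poly T p v = 0" by auto
    obtain q where q: "q \<noteq> 0" "op_poly T q (op_poly T p b) = 0"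
      using single[of "op_poly T p b"] insert.prems by auto
    show ?case
      using p q insert.prems by (intro exI[of _ "q * p"]) (auto simp: op_poly_mult subset_iff)
  qed
  moreover have CV: "C \<subseteq> carrier V" using C span_superset by blast
  ultimately obtain p where p: "p \<noteq> 0" "\<forall>v\<in>C. op_poly T p v = 0" using C by blast
  have "subspace {v \<in> carrier V. op_poly T p v = 0}"
    by (rule subspaceI) (auto simp: op_poly_add op_poly_scale)
  then have "span C \<subseteq> {v \<in> carrier V. op_poly T p v = 0}"
    using p CV by (intro span_minimal) auto
  then show ?thesis using p C by auto
qed

text \<open>
  The relation says that \<open>[D, T] = a T\<close>, whence \<open>[D, q(T)] = a T q'(T)\<close> for every polynomial \<open>q\<close>. For
  the minimal polynomial \<open>p\<close> of \<open>T\<close>, of degree \<open>d\<close>, it follows that \<open>X p'\<close> annihilates \<open>T\<close> too, and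
  \<open>d p - X p'\<close> is an annihilating polynomial without a term of degree \<open>d\<close>. It must vanish, which
  leaves \<open>p\<close> no other term than its leading one.
\<close>

lemma nilpotent_if_scaled_by_commutator:
  fixes D :: "'a \<Rightarrow> 'a" and a :: 'k
  assumes D: "linear_between V V D" and a: "a \<noteq> 0" and char0: "\<And>n::nat. n > 0 \<Longrightarrow> (of_nat n :: 'k) \<noteq> 0"
    and comm: "\<And>v. v \<in> carrier V \<Longrightarrow> D (T v) = T (D v) + scale V a (T v)"
  obtains k where "\<And>v. v \<in> carrier V \<Longrightarrow> (T ^^ k) v = 0"
proof -
  interpret D: fd_op V D by standard (rule D)
  define P where "P p \<longleftrightarrow> p \<noteq> 0 \<and> (\<forall>v\<in>carrier V. op_poly T p v = 0)" for p
  have "\<exists>p. P p" using exists_annihilating_poly by (auto simp: P_def)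
  then obtain p where p: "P p" and least: "\<And>q. P q \<Longrightarrow> degree p \<le> degree q"
    using ex_has_least_nat[of P _ degree] by blast
  have der: "D (op_poly T q v) = op_poly T q (D v) + scale V a (op_poly T (pCons 0 (pderiv q)) v)"
    if v: "v \<in> carrier V" for q v
  proof (induction q)
    case (pCons c q)
    have "D (op_poly T (pCons c q) v) = scale V c (D v) + (T (D (op_poly T q v)) + scale V a (T (op_poly T q v)))"
      using v by (simp add: D.T_add D.T_scale comm)
    also have "\<dots> = op_poly T (pCons c q) (D v)
        + scale V a (T (op_poly T q v + op_poly T (pCons 0 (pderiv q)) v))"
      using v by (simp add: pCons.IH T_add T_scale scale_right_distrib algebra_simps)
    finally show ?case using v by (simp add: pderiv_pCons op_poly_plus del: op_poly_pCons(1))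
      (simp add: op_poly_plus v)
  qed simp
  \<comment> \<open>The \<open>k\<close>-th coefficient is \<open>(d - k)\<close> times that of \<open>p\<close>, so the leading term cancels.\<close>
  define q where "q = smult (of_nat (degree p)) p - pCons 0 (pderiv p)"
  have ann: "op_poly T q v = 0" if v: "v \<in> carrier V" for v
  proof -
    have "scale V a (op_poly T (pCons 0 (pderiv p)) v) = 0"
      using der[OF v, of p] p v by (simp add: P_def)
    then have "op_poly T (pCons 0 (pderiv p)) v = 0" using a by simp
    then show ?thesis using p v by (simp add: q_def op_poly_minus op_poly_smult P_def)
  qed
  have cq: "coeff q k = (of_nat (degree p) - of_nat k) * coeff p k" for k
    by (cases k) (simp_all add: q_def coeff_pderiv algebra_simps)
  have "q = 0"
  proof (rule ccontr)
    assume nz: "q \<noteq> 0"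
    then have "degree p \<le> degree q" using ann least P_def by blast
    moreover have lc: "lead_coeff q \<noteq> 0" using nz by simp
    ultimately have "degree q = degree p"
      using cq[of "degree q"] by (metis coeff_eq_0 le_neq_implies_less mult_zero_right)
    then show False using cq[of "degree q"] lc by simp
  qed
  then have z: "coeff p k = 0" if "k < degree p" for k
    using cq[of k] char0[of "degree p - k"] that by (simp add: of_nat_diff)
  have "p = monom (lead_coeff p) (degree p)"
    by (rule poly_eqI) (metis coeff_eq_0 coeff_monom linorder_neqE_nat z)
  then have "scale V (lead_coeff p) ((T ^^ degree p) v) = 0" if "v \<in> carrier V" for v
    using p that op_poly_monom by (metis P_def)
  then show thesis using that[of "degree p"] p by (simp add: P_def)
qed

end

section \<open>Highest weight strings in \<open>sl2\<close>-modules\<close>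

definition sl2_E :: "'k::field_char_0 ^ 2 ^ 2" where
  "sl2_E = (\<chi> i j. if i = 1 \<and> j = 2 then 1 else 0)"

definition sl2_F :: "'k::field_char_0 ^ 2 ^ 2" where
  "sl2_F = (\<chi> i j. if i = 2 \<and> j = 1 then 1 else 0)"

definition sl2_H :: "'k::field_char_0 ^ 2 ^ 2" where
  "sl2_H = (\<chi> i j. if i = j then (if i = 1 then 1 else - 1) else 0)"

lemmas matrix2_simps = vec_eq_iff forall_2 sum_2 matrix_matrix_mult_def trace_def sl2_def

lemma EFH_carrier [simp]:
  "sl2_E \<in> carrier sl2" "sl2_F \<in> carrier sl2" "sl2_H \<in> carrier sl2"
  by (simp_all add: matrix2_simps sl2_E_def sl2_F_def sl2_H_def)

lemma sl2_decompose:
  assumes "s \<in> carrier sl2"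
  shows "s = scale sl2 (s $ 1 $ 1) sl2_H + (scale sl2 (s $ 1 $ 2) sl2_E + scale sl2 (s $ 2 $ 1) sl2_F)"
  using assms by (simp add: matrix2_simps sl2_E_def sl2_F_def sl2_H_def add_eq_0_iff)

lemma sl2_relations:
  "brk sl2 sl2_H sl2_E = scale sl2 2 sl2_E"
  "brk sl2 sl2_H sl2_F = scale sl2 (- 2) sl2_F"
  "brk sl2 sl2_E sl2_F = sl2_H"
  by (simp_all add: matrix2_simps sl2_E_def sl2_F_def sl2_H_def)

lemma fin_dim_sl2: "fin_dim_space (sl2 :: ('k::field_char_0, 'k ^ 2 ^ 2) lie_alg)"
proof -
  have vs: "vector_space (scale (sl2 :: ('k, 'k ^ 2 ^ 2) lie_alg))"
    by unfold_locales (simp_all add: matrix2_simps algebra_simps)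
  interpret vector_space "scale (sl2 :: ('k, 'k ^ 2 ^ 2) lie_alg)" by (rule vs)
  have "subspace (carrier sl2)"
    by (rule subspaceI) (simp_all add: matrix2_simps algebra_simps flip: distrib_left)
  then have "span {sl2_E, sl2_F, sl2_H} \<subseteq> carrier sl2"
    by (intro span_minimal) auto
  moreover have "s \<in> span {sl2_E, sl2_F, sl2_H}" if "s \<in> carrier sl2" for s
    by (subst sl2_decompose[OF that]) (intro span_add span_scale span_base; simp)
  ultimately show ?thesis
    unfolding fin_dim_space_def using vs
    by (intro conjI exI[of _ "{sl2_E, sl2_F, sl2_H}"]) auto
qed

lemma lie_algebra_sl2: "lie_algebra (sl2 :: ('k::field_char_0, 'k ^ 2 ^ 2) lie_alg)"
  unfolding lie_algebra_def
proof (intro conjI ballI)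
  fix x y z :: "'k ^ 2 ^ 2"
  assume c: "x \<in> carrier sl2" "y \<in> carrier sl2" "z \<in> carrier sl2"
  show "brk sl2 x (brk sl2 y z) + brk sl2 y (brk sl2 z x) + brk sl2 z (brk sl2 x y) = 0"
    by (simp add: matrix2_simps algebra_simps)
next
  fix x :: "'k ^ 2 ^ 2"
  assume "x \<in> carrier sl2"
  show "linear_between sl2 sl2 (brk sl2 x)" "linear_between sl2 sl2 (\<lambda>y. brk sl2 y x)"
    by (simp_all add: linear_between_def matrix2_simps algebra_simps)
  show "brk sl2 x x = 0" by (simp add: sl2_def)
qed (rule fin_dim_sl2)

lemma lie_module_submodule:
  assumes "lie_module S V \<rho>" "subspace_of V W" "stable S \<rho> W"
  shows "lie_module S (V\<lparr>carrier := W\<rparr>) \<rho>"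
proof -
  interpret fd_space V using assms(1) by unfold_locales (simp add: lie_module_def)
  have "fin_dim_space (V\<lparr>carrier := W\<rparr>)"
    using assms(2) by (intro fin_dim_subspace) (auto simp: subspace_of_def)
  then show ?thesis
    using assms unfolding lie_module_def linear_between_def stable_def subspace_of_def
    by (auto simp: subset_iff)
qed

text \<open>
  The carrier of \<^term>\<open>coord_space n\<close>, for use as a set of coordinate vectors independently of a
  vector space structure.
\<close>

definition coords :: "nat \<Rightarrow> (nat \<Rightarrow> 'k::zero) set" where
  "coords n = {x. \<forall>i\<ge>n. x i = 0}"

lemma zero_coords [simp]: "0 \<in> coords n"
  by (simp add: coords_def)

lemma coords_closed:
  fixes x y :: "nat \<Rightarrow> 'k::field"
  shows "x \<in> coords n \<Longrightarrow> y \<in> coords n \<Longrightarrow> x + y \<in> coords n"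
    and "x \<in> coords n \<Longrightarrow> (\<lambda>i. c * x i) \<in> coords n"
  by (auto simp: coords_def)

definition comb :: "('k, 'a::comm_monoid_add, 'm) vspace_scheme \<Rightarrow> nat \<Rightarrow> (nat \<Rightarrow> 'a) \<Rightarrow> (nat \<Rightarrow> 'k) \<Rightarrow> 'a" where
  "comb V n w x = (\<Sum>i<n. scale V (x i) (w i))"

text \<open>
  The vectors \<open>v, F v, F\<^sup>2 v, \<dots>\<close> for a highest weight vector \<open>v\<close>, continued by zeros from index \<open>n\<close>
  on. The coefficient in the last clause vanishes at \<open>i = 0\<close>, where the index \<open>i - 1\<close> is truncated, and
  at \<open>i = n\<close>, where the string has ended but its predecessor is nonzero.
\<close>

definition hw_string ::
  "('k::field_char_0, 'a::ab_group_add, 'm) vspace_scheme \<Rightarrow> ('k ^ 2 ^ 2 \<Rightarrow> 'a \<Rightarrow> 'a)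
    \<Rightarrow> nat \<Rightarrow> (nat \<Rightarrow> 'a) \<Rightarrow> bool" where
  "hw_string V \<rho> n w \<longleftrightarrow>
     (\<forall>i. w i \<in> carrier V) \<and> (\<forall>i. w i = 0 \<longleftrightarrow> n \<le> i) \<and>
     (\<forall>i. \<rho> sl2_F (w i) = w (Suc i)) \<and>
     (\<forall>i. \<rho> sl2_H (w i) = scale V (of_nat n - 1 - 2 * of_nat i) (w i)) \<and>
     (\<forall>i. \<rho> sl2_E (w i) = scale V (of_nat i * (of_nat n - of_nat i)) (w (i - 1)))"

text \<open>
  The action in the coordinates with respect to a string. It depends only on the length \<open>n\<close>, which
  is why modules spanned by strings of equal length are isomorphic. Recall that an element of
  \<open>sl2\<close> is \<open>a H + b E + c F\<close> for its entries \<open>a\<close>, \<open>b\<close> and \<open>c\<close> at the positions \<open>(1,1)\<close>, \<open>(1,2)\<close> and \<open>(2,1)\<close>.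
\<close>

definition str_act :: "nat \<Rightarrow> 'k::field_char_0 ^ 2 ^ 2 \<Rightarrow> (nat \<Rightarrow> 'k) \<Rightarrow> nat \<Rightarrow> 'k" where
  "str_act n s x i =
     s $ 1 $ 1 * (of_nat n - 1 - 2 * of_nat i) * x i +
     s $ 1 $ 2 * (of_nat (Suc i) * (of_nat n - 1 - of_nat i)) * x (Suc i) +
     s $ 2 $ 1 * (if i = 0 \<or> n \<le> i then 0 else x (i - 1))"

lemma str_act_coords:
  assumes "x \<in> coords n" shows "str_act n s x \<in> coords n"
  using assms by (auto simp: coords_def str_act_def)

definition unit_vec :: "nat \<Rightarrow> nat \<Rightarrow> 'k::zero_neq_one" where
  "unit_vec i = (\<lambda>j. if j = i then 1 else 0)"

lemma unit_vec_coords: "i < n \<Longrightarrow> unit_vec i \<in> coords n"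
  by (auto simp: coords_def unit_vec_def)

lemma (in fd_space) comb_unit_vec:
  assumes "i < n" shows "comb V n w (unit_vec i) = w i"
proof -
  have "(\<Sum>j<n. scale V (unit_vec i j) (w j)) = (\<Sum>j<n. if j = i then w i else 0)"
    by (rule sum.cong) (auto simp: unit_vec_def)
  then show ?thesis using assms by (simp add: comb_def)
qed

lemma (in fd_space) comb_add: "comb V n w (x + y) = comb V n w x + comb V n w y"
  by (simp add: comb_def scale_left_distrib sum.distrib)

lemma (in fd_space) comb_scale: "comb V n w (\<lambda>i. c * x i) = scale V c (comb V n w x)"
  by (simp add: comb_def scale_sum_right)

lemma linear_between_comb:
  assumes V: "fin_dim_space V" and W: "fin_dim_space W"
    and f: "linear_between V W f" and w: "\<And>i. i < n \<Longrightarrow> w i \<in> carrier V"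
  shows "f (comb V n w x) = comb W n (\<lambda>i. f (w i)) x"
proof -
  interpret V: fd_space V by unfold_locales (rule V)
  interpret W: fd_space W by unfold_locales (rule W)
  have f0: "f 0 = 0"
  proof -
    have "f (scale V 0 0) = scale W 0 (f 0)" using f V.carrier_zero unfolding linear_between_def by blast
    then show ?thesis by simp
  qed
  have "(\<Sum>i<m. scale V (x i) (w i)) \<in> carrier V \<and>
      f (\<Sum>i<m. scale V (x i) (w i)) = (\<Sum>i<m. scale W (x i) (f (w i)))" if "m \<le> n" for m
    using that
  proof (induction m)
    case (Suc m)
    then show ?case using f w by (simp add: linear_between_def)
  qed (simp add: f0)
  then show ?thesis by (auto simp: comb_def)
qed

locale sl2_module =
  fixes V :: "('k::field_char_0, 'a::ab_group_add, 'm) vspace_scheme"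
    and \<rho> :: "'k ^ 2 ^ 2 \<Rightarrow> 'a \<Rightarrow> 'a"
  assumes mod: "lie_module sl2 V \<rho>"
begin

sublocale fd_space V
  using mod by unfold_locales (simp add: lie_module_def)

abbreviation "E \<equiv> \<rho> sl2_E"
abbreviation "F \<equiv> \<rho> sl2_F"
abbreviation "H \<equiv> \<rho> sl2_H"

lemma lin_act: "s \<in> carrier sl2 \<Longrightarrow> linear_between V V (\<rho> s)"
  using mod by (simp add: lie_module_def)

sublocale E: fd_op V E by unfold_locales (simp add: lin_act)
sublocale F: fd_op V F by unfold_locales (simp add: lin_act)
sublocale H: fd_op V H by unfold_locales (simp add: lin_act)

lemma act_carrier: "s \<in> carrier sl2 \<Longrightarrow> x \<in> carrier V \<Longrightarrow> \<rho> s x \<in> carrier V"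
  using lin_act by (simp add: linear_between_def)

lemma act_zero: "s \<in> carrier sl2 \<Longrightarrow> \<rho> s 0 = 0"
  using fd_op.T_zero[of V "\<rho> s"] lin_act fd_space_axioms by (simp add: fd_op_def fd_op_axioms_def)

lemma act_add: "s \<in> carrier sl2 \<Longrightarrow> x \<in> carrier V \<Longrightarrow> y \<in> carrier V \<Longrightarrow> \<rho> s (x + y) = \<rho> s x + \<rho> s y"
  and act_scale: "s \<in> carrier sl2 \<Longrightarrow> x \<in> carrier V \<Longrightarrow> \<rho> s (scale V c x) = scale V c (\<rho> s x)"
  using lin_act unfolding linear_between_def by blast+

lemma subspace_invariants: "subspace {x \<in> carrier V. \<forall>s\<in>carrier sl2. \<rho> s x = 0}"
  by (rule subspaceI) (auto simp: act_zero act_add act_scale)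

lemma act_bracket:
  "s \<in> carrier sl2 \<Longrightarrow> t \<in> carrier sl2 \<Longrightarrow> x \<in> carrier V \<Longrightarrow>
     \<rho> (brk sl2 s t) x = \<rho> s (\<rho> t x) - \<rho> t (\<rho> s x)"
  using mod by (simp add: lie_module_def)

lemma act_linear_left: "x \<in> carrier V \<Longrightarrow> linear_between sl2 V (\<lambda>s. \<rho> s x)"
  using mod by (simp add: lie_module_def)

lemma act_decompose:
  assumes s: "s \<in> carrier sl2" and x: "x \<in> carrier V"
  shows "\<rho> s x = scale V (s $ 1 $ 1) (H x) + (scale V (s $ 1 $ 2) (E x) + scale V (s $ 2 $ 1) (F x))"
proof -
  interpret S: fd_space "sl2 :: ('k, 'k ^ 2 ^ 2) lie_alg" by unfold_locales (rule fin_dim_sl2)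
  have add: "\<rho> (a + b) x = \<rho> a x + \<rho> b x" if "a \<in> carrier sl2" "b \<in> carrier sl2" for a b
    using act_linear_left[OF x] that by (simp add: linear_between_def)
  have sc: "\<rho> (scale sl2 c a) x = scale V c (\<rho> a x)" if "a \<in> carrier sl2" for a c
    using act_linear_left[OF x] that by (simp add: linear_between_def)
  show ?thesis by (subst sl2_decompose[OF s]) (simp add: add sc)
qed

lemma HE: "x \<in> carrier V \<Longrightarrow> H (E x) = E (H x) + scale V 2 (E x)"
  and HF: "x \<in> carrier V \<Longrightarrow> H (F x) = F (H x) + scale V (- 2) (F x)"
  and EF: "x \<in> carrier V \<Longrightarrow> E (F x) = F (E x) + H x"
proof -
  assume x: "x \<in> carrier V"
  have sc: "\<rho> (scale sl2 c a) x = scale V c (\<rho> a x)" if "a \<in> carrier sl2" for a c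
    using act_linear_left[OF x] that by (simp add: linear_between_def)
  show "H (E x) = E (H x) + scale V 2 (E x)"
    using act_bracket[OF EFH_carrier(3,1) x] unfolding sl2_relations
    by (subst (asm) sc) (auto simp: algebra_simps)
  show "H (F x) = F (H x) + scale V (- 2) (F x)"
    using act_bracket[OF EFH_carrier(3,2) x] unfolding sl2_relations
    by (subst (asm) sc) (auto simp: algebra_simps)
  show "E (F x) = F (E x) + H x"
    using act_bracket[OF EFH_carrier(1,2) x] unfolding sl2_relations
    by (auto simp: algebra_simps)
qed

lemma F_pow_carrier [simp]: "x \<in> carrier V \<Longrightarrow> (F ^^ k) x \<in> carrier V"
  by (induction k) auto

lemma F_pow_add: "x \<in> carrier V \<Longrightarrow> y \<in> carrier V \<Longrightarrow> (F ^^ k) (x + y) = (F ^^ k) x + (F ^^ k) y"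
  by (induction k) (auto simp: F.T_add)

lemma F_pow_scale: "x \<in> carrier V \<Longrightarrow> (F ^^ k) (scale V c x) = scale V c ((F ^^ k) x)"
  by (induction k) (auto simp: F.T_scale)

lemma H_F_pow:
  assumes v: "v \<in> carrier V"
  shows "H ((F ^^ k) v) = (F ^^ k) (H v) + scale V (- 2 * of_nat k) ((F ^^ k) v)"
proof (induction k)
  case (Suc k)
  have "H ((F ^^ Suc k) v) = F (H ((F ^^ k) v)) + scale V (- 2) (F ((F ^^ k) v))"
    using v by (simp add: HF)
  also have "\<dots> = F ((F ^^ k) (H v)) + (scale V (- 2 * of_nat k) (F ((F ^^ k) v)) + scale V (- 2) (F ((F ^^ k) v)))"
    using v by (simp add: Suc.IH F.T_add F.T_scale del: scale_minus_left)
  also have "\<dots> = F ((F ^^ k) (H v)) + scale V (- 2 * of_nat (Suc k)) (F ((F ^^ k) v))"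
    unfolding scale_left_distrib[symmetric] by (simp add: algebra_simps)
  finally show ?case by simp
qed simp

text \<open>
  On vectors killed by \<open>E\<close>, the product \<open>E F\<^sup>k\<^sup>+\<^sup>1\<close> acts as \<open>(k+1) F\<^sup>k (H - k)\<close>. Unlike the usual formula for
  weight vectors, this does not presuppose that \<open>v\<close> is an eigenvector of \<open>H\<close>, which makes it
  usable for finding an eigenvector.
\<close>

lemma E_F_pow:
  assumes v: "v \<in> carrier V" and Ev: "E v = 0"
  shows "E ((F ^^ Suc k) v) = (F ^^ k) (scale V (of_nat (Suc k)) (H v - scale V (of_nat k) v))"
proof (induction k)
  case 0
  then show ?case using v Ev by (simp add: EF)
next
  case (Suc k)
  let ?P = "(F ^^ Suc k) (H v)" and ?Q = "(F ^^ Suc k) v"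
  have exp: "(F ^^ j) (scale V c (H v - scale V d v)) = scale V c ((F ^^ j) (H v)) + scale V (- (c * d)) ((F ^^ j) v)" for j c d
    using v F_pow_add[of "scale V c (H v)" "scale V (- (c * d)) v" j]
    by (simp add: F_pow_scale scale_right_diff_distrib del: scale_minus_left)
       (simp add: scale_minus_left)
  have "E ((F ^^ Suc (Suc k)) v) = F (E ?Q) + H ?Q"
    using v EF[of ?Q] by simp
  also have "F (E ?Q) = (F ^^ Suc k) (scale V (of_nat (Suc k)) (H v - scale V (of_nat k) v))"
    by (subst Suc.IH) simp
  also have "\<dots> = scale V (of_nat (Suc k)) ?P + scale V (- (of_nat (Suc k) * of_nat k)) ?Q"
    by (rule exp)
  also have "H ?Q = ?P + scale V (- 2 * of_nat (Suc k)) ?Q" by (rule H_F_pow[OF v])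
  also have "scale V (of_nat (Suc k)) ?P + scale V (- (of_nat (Suc k) * of_nat k)) ?Q
      + (?P + scale V (- 2 * of_nat (Suc k)) ?Q)
    = scale V (of_nat (Suc k) + 1) ?P + scale V (- (of_nat (Suc k) * of_nat k) + - 2 * of_nat (Suc k)) ?Q"
    by (simp only: scale_left_distrib scale_one ac_simps)
  also have "\<dots> = scale V (of_nat (Suc (Suc k))) ?P
      + scale V (- (of_nat (Suc (Suc k)) * of_nat (Suc k))) ?Q"
    by (simp add: algebra_simps del: scale_left_distrib scale_minus_left)
  finally show ?case unfolding exp .
qed

text \<open>
  The kernel of the nilpotent operator \<open>E\<close> is nonzero and stable under \<open>H\<close>. Let \<open>F\<^sup>k\<^sup>+\<^sup>1 v = 0\<close> for some
  \<open>v\<close> in this kernel. Then the vector \<open>(k+1) (H - k) v\<close> lies in the kernel and is killed by \<open>F\<^sup>k\<close>; either it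
  vanishes and \<open>v\<close> has weight \<open>k\<close>, or it continues the descent with a smaller exponent.
\<close>

lemma exists_highest_weight_vector:
  assumes "carrier V \<noteq> {0}"
  shows "\<exists>v \<mu>. v \<in> carrier V \<and> v \<noteq> 0 \<and> E v = 0 \<and> H v = scale V \<mu> v"
proof -
  obtain x where x: "x \<in> carrier V" "x \<noteq> 0"
    using assms carrier_zero by blast
  obtain m where m: "\<And>v. v \<in> carrier V \<Longrightarrow> (E ^^ m) v = 0"
    using E.nilpotent_if_scaled_by_commutator[OF H.lin, of 2] HE by auto
  define j where "j = (LEAST j. (E ^^ j) x = 0)"
  have j: "(E ^^ j) x = 0" unfolding j_def using m[OF x(1)] by (rule LeastI)
  have "j \<noteq> 0" using j x by (cases j) auto
  then obtain i where i: "j = Suc i" by (cases j) auto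
  have "(E ^^ i) x \<noteq> 0" using not_less_Least[of i "\<lambda>j. (E ^^ j) x = 0"] i j_def by auto
  moreover have "(E ^^ i) x \<in> carrier V" using x by (induction i) auto
  moreover have "E ((E ^^ i) x) = 0" using j i by simp
  ultimately obtain y where y: "y \<in> carrier V" "y \<noteq> 0" "E y = 0" by blast
  obtain k where k: "\<And>v. v \<in> carrier V \<Longrightarrow> (F ^^ k) v = 0"
    using F.nilpotent_if_scaled_by_commutator[OF H.lin, of "- 2"] HF by auto
  have "\<exists>v \<mu>. v \<in> carrier V \<and> v \<noteq> 0 \<and> E v = 0 \<and> H v = scale V \<mu> v"
    if "v \<in> carrier V" "v \<noteq> 0" "E v = 0" "(F ^^ k) v = 0" for k v
    using that
  proof (induction k arbitrary: v)
    case (Suc k)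
    define u where "u = scale V (of_nat (Suc k)) (H v - scale V (of_nat k) v)"
    show ?case
    proof (cases "u = 0")
      case True
      then have "H v = scale V (of_nat k) v" by (simp add: u_def del: of_nat_Suc)
      then show ?thesis using Suc.prems by blast
    next
      case False
      have "E (H v) = 0" using HE[of v] Suc.prems by simp
      then have "E u = 0" using Suc.prems by (simp add: u_def E.T_scale E.T_diff)
      moreover have "(F ^^ k) u = 0"
        using E_F_pow[of v k] Suc.prems unfolding u_def by simp
      moreover have "u \<in> carrier V" using Suc.prems by (simp add: u_def)
      ultimately show ?thesis using Suc.IH False by blast
    qed
  qed simp
  then show ?thesis using y k by blast
qed

text \<open>
  The weight is forced: if \<open>n\<close> is least with \<open>F\<^sup>n v = 0\<close>, then applying \<open>E\<close> gives
  \<open>n (\<mu> - (n - 1)) F\<^sup>n\<^sup>-\<^sup>1 v = 0\<close>.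
\<close>

lemma hw_string_of_highest_weight_vector:
  assumes v: "v \<in> carrier V" "v \<noteq> 0" "E v = 0" and \<mu>: "H v = scale V \<mu> v"
  obtains n where "n \<ge> 1" "\<mu> = of_nat n - 1" "hw_string V \<rho> n (\<lambda>i. (F ^^ i) v)"
proof -
  obtain k where k: "\<And>v. v \<in> carrier V \<Longrightarrow> (F ^^ k) v = 0"
    using F.nilpotent_if_scaled_by_commutator[OF H.lin, of "- 2"] HF by auto
  define n where "n = (LEAST j. (F ^^ j) v = 0)"
  have n: "(F ^^ n) v = 0" unfolding n_def using k[OF v(1)] by (rule LeastI)
  have "n \<noteq> 0" using n v by (cases n) auto
  then obtain m where m: "n = Suc m" by (cases n) auto
  have nz: "(F ^^ i) v \<noteq> 0" if "i < n" for i
    using not_less_Least[of i "\<lambda>j. (F ^^ j) v = 0"] that n_def by auto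
  have z: "(F ^^ i) v = 0" if "n \<le> i" for i
  proof -
    have "(F ^^ i) v = (F ^^ (i - n)) ((F ^^ n) v)"
      using that by (simp flip: funpow_add[THEN fun_cong, unfolded o_apply])
    also have "\<dots> = 0" unfolding n using F_pow_scale[of 0 "i - n" 0] by simp
    finally show ?thesis .
  qed
  have EFS: "E ((F ^^ Suc i) v) = scale V (of_nat (Suc i) * (\<mu> - of_nat i)) ((F ^^ i) v)" for i
    using E_F_pow[of v i] v \<mu>
    by (simp add: F_pow_scale flip: scale_left_diff_distrib del: of_nat_Suc funpow.simps)
  have "of_nat (Suc m) * (\<mu> - of_nat m) = 0"
    using EFS[of m] n nz[of m] m by (simp del: of_nat_Suc funpow.simps)
  then have mu: "\<mu> = of_nat n - 1" using m by (simp del: of_nat_Suc) simp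
  have "hw_string V \<rho> n (\<lambda>i. (F ^^ i) v)"
    unfolding hw_string_def
  proof (intro conjI allI)
    fix i
    show "(F ^^ i) v \<in> carrier V" using v by simp
    show "((F ^^ i) v = 0) = (n \<le> i)" using z nz by (meson not_le)
    show "F ((F ^^ i) v) = (F ^^ Suc i) v" by simp
    show "H ((F ^^ i) v) = scale V (of_nat n - 1 - 2 * of_nat i) ((F ^^ i) v)"
      using H_F_pow[of v i] v
      by (simp add: \<mu> F_pow_scale mu flip: scale_left_diff_distrib)
    show "E ((F ^^ i) v) = scale V (of_nat i * (of_nat n - of_nat i)) ((F ^^ (i - 1)) v)"
    proof (cases i)
      case (Suc k)
      then show ?thesis using EFS[of k] by (simp add: mu algebra_simps)
    qed (use v in simp)
  qed
  then show thesis using that[of n] m mu by simp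
qed

lemma exists_hw_string:
  assumes "carrier V \<noteq> {0}"
  obtains n w where "n \<ge> 1" "hw_string V \<rho> n w"
  using exists_highest_weight_vector[OF assms] hw_string_of_highest_weight_vector by metis

context
  fixes n w assumes w: "hw_string V \<rho> n w"
begin

lemma hw_string_carrier [simp]: "w i \<in> carrier V"
  using w by (simp add: hw_string_def)

lemma comb_carrier: "comb V n w x \<in> carrier V"
  by (simp add: comb_def)

text \<open>
  If \<open>i\<close> is the first index with a nonzero coefficient in a relation, the power \<open>F\<^sup>n\<^sup>-\<^sup>1\<^sup>-\<^sup>i\<close> moves the
  \<open>i\<close>-th term to the last vector of the string and kills all later ones.
\<close>

lemma hw_string_indep: "seq_indep n w"
  unfolding seq_indep_def
proof (intro allI impI)
  fix c i assume c: "(\<Sum>i<n. scale V (c i) (w i)) = 0" and "i < n"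
  from \<open>i < n\<close> show "c i = 0"
  proof (induction i rule: less_induct)
    case (less i)
    have F_w: "(F ^^ k) (w j) = w (j + k)" for j k
      using w by (induction k) (auto simp: hw_string_def)
    let ?k = "n - 1 - i"
    have lin: "linear_between V V (F ^^ ?k)"
      by (auto simp: linear_between_def F_pow_add F_pow_scale)
    have "0 = (F ^^ ?k) (comb V n w c)"
      using F_pow_scale[of 0 ?k 0] by (simp add: comb_def c)
    also have "\<dots> = (\<Sum>j<n. scale V (c j) (w (j + ?k)))"
      by (subst linear_between_comb[OF fin_dim fin_dim lin]) (simp_all add: comb_def F_w)
    also have "\<dots> = (\<Sum>j<n. if j = i then scale V (c i) (w (n - 1)) else 0)"
    proof (rule sum.cong, simp)
      fix j assume "j \<in> {..<n}"
      then consider "j < i" | "j = i" | "i < j" by linarith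
      then show "scale V (c j) (w (j + ?k)) = (if j = i then scale V (c i) (w (n - 1)) else 0)"
      proof cases
        case 1
        then show ?thesis using less \<open>j \<in> {..<n}\<close> by simp
      next
        case 2
        then show ?thesis using less.prems by simp
      next
        case 3
        then have "w (j + ?k) = 0" using w by (simp add: hw_string_def)
        then show ?thesis using 3 by simp
      qed
    qed
    also have "\<dots> = scale V (c i) (w (n - 1))" using less.prems by simp
    finally show ?case using w less.prems by (auto simp: hw_string_def)
  qed
qed

lemma comb_inj:
  assumes "x \<in> coords n" "y \<in> coords n" "comb V n w x = comb V n w y"
  shows "x = y"
proof
  fix i
  have "(\<Sum>i<n. scale V (x i - y i) (w i)) = 0"
    using assms(3) by (simp add: comb_def scale_left_diff_distrib sum_subtractf)
  then have "\<forall>i<n. x i - y i = 0"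
    using hw_string_indep[unfolded seq_indep_def, rule_format, of "\<lambda>i. x i - y i"] by blast
  then show "x i = y i" using assms(1,2) by (cases "i < n") (auto simp: coords_def)
qed

lemma act_comb:
  assumes s: "s \<in> carrier sl2"
  shows "\<rho> s (comb V n w x) = comb V n w (str_act n s x)"
proof -
  have act: "\<rho> t (comb V n w x) = (\<Sum>i<n. scale V (x i) (\<rho> t (w i)))" if "t \<in> carrier sl2" for t
    using linear_between_comb[OF fin_dim fin_dim lin_act[OF that]] by (simp add: comb_def)
  have H: "H (comb V n w x) = (\<Sum>i<n. scale V ((of_nat n - 1 - 2 * of_nat i) * x i) (w i))"
    using w by (simp add: act hw_string_def mult.commute)
  have F: "F (comb V n w x) = (\<Sum>i<n. scale V (if i = 0 then 0 else x (i - 1)) (w i))"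
  proof (cases n)
    case (Suc m)
    have "w (Suc m) = 0" using w Suc by (simp add: hw_string_def)
    have "F (comb V n w x) = (\<Sum>i<Suc m. scale V (x i) (w (Suc i)))"
      unfolding act[OF EFH_carrier(2)] using w Suc by (simp add: hw_string_def)
    also have "\<dots> = (\<Sum>i<m. scale V (x i) (w (Suc i)))" using \<open>w (Suc m) = 0\<close> by simp
    also have "\<dots> = (\<Sum>i<Suc m. scale V (if i = 0 then 0 else x (i - 1)) (w i))"
      unfolding sum.lessThan_Suc_shift by simp
    finally show ?thesis using Suc by simp
  qed (simp add: comb_def)
  have E: "E (comb V n w x) = (\<Sum>i<n. scale V ((of_nat (Suc i) * (of_nat n - 1 - of_nat i)) * x (Suc i)) (w i))"
  proof (cases n)
    case (Suc m)
    have "E (comb V n w x) = (\<Sum>i<Suc m. scale V (x i * (of_nat i * (of_nat n - of_nat i))) (w (i - 1)))"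
      unfolding act[OF EFH_carrier(1)] using w Suc by (simp add: hw_string_def)
    also have "\<dots> = (\<Sum>i<m. scale V (x (Suc i) * (of_nat (Suc i) * (of_nat n - of_nat (Suc i)))) (w i))"
      unfolding sum.lessThan_Suc_shift by simp
    also have "\<dots> = (\<Sum>i<Suc m. scale V ((of_nat (Suc i) * (of_nat n - 1 - of_nat i)) * x (Suc i)) (w i))"
      using Suc by (simp add: algebra_simps)
    finally show ?thesis using Suc by simp
  qed (simp add: comb_def)
  show ?thesis
    unfolding act_decompose[OF s comb_carrier] H E F scale_sum_right
    unfolding comb_def sum.distrib[symmetric]
    by (rule sum.cong) (simp_all add: str_act_def mult.assoc flip: scale_left_distrib)
qed

lemma comb_image_stable: "stable sl2 \<rho> (comb V n w ` coords n)"
  unfolding stable_def using act_comb str_act_coords by blast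

lemma comb_image_subspace: "subspace (comb V n w ` coords n)"
proof (rule subspaceI)
  have "comb V n w 0 = 0" "0 \<in> coords n" by (simp_all add: comb_def coords_def)
  then show "0 \<in> comb V n w ` coords n" by (metis imageI)
next
  fix a b assume "a \<in> comb V n w ` coords n" "b \<in> comb V n w ` coords n"
  then obtain x y where "a = comb V n w x" "b = comb V n w y" "x \<in> coords n" "y \<in> coords n" by blast
  then show "a + b \<in> comb V n w ` coords n"
    using coords_closed(1)[of x n y] by (simp flip: comb_add)
next
  fix c a assume "a \<in> comb V n w ` coords n"
  then obtain x where "a = comb V n w x" "x \<in> coords n" by blast
  then show "scale V c a \<in> comb V n w ` coords n"
    using coords_closed(2)[of x n c] by (simp flip: comb_scale)
qed

end

end

section \<open>The irreducible module of dimension \<open>n\<close>\<close>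

lemma coord_space_simps [simp]:
  "carrier (coord_space n) = coords n" "scale (coord_space n) = (\<lambda>c x i. c * x i)"
  by (simp_all add: coord_space_def coords_def)

lemma sum_fun_apply: "(\<Sum>i\<in>A. f i) j = (\<Sum>i\<in>A. f i j :: 'k::comm_monoid_add)"
  by (induction A rule: infinite_finite_induct) auto

lemma coords_eq_sum_unit_vec:
  assumes "x \<in> coords n"
  shows "x = (\<Sum>i<n. (\<lambda>j. x i * (unit_vec i j :: 'k::field)))"
proof
  fix j
  have "(\<Sum>i<n. x i * unit_vec i j) = (\<Sum>i<n. if i = j then x j else 0)"
    by (rule sum.cong) (auto simp: unit_vec_def)
  then show "x j = (\<Sum>i<n. (\<lambda>j. x i * unit_vec i j)) j"
    using assms by (auto simp: sum_fun_apply coords_def)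
qed

lemma vector_space_coord_space: "vector_space (scale (coord_space n :: ('k::field, nat \<Rightarrow> 'k) vspace))"
  by unfold_locales (simp_all add: fun_eq_iff algebra_simps)

lemma span_unit_vec:
  "module.span (scale (coord_space n :: ('k::field, nat \<Rightarrow> 'k) vspace)) (unit_vec ` {..<n}) = coords n"
proof -
  interpret vector_space "scale (coord_space n :: ('k, nat \<Rightarrow> 'k) vspace)"
    by (rule vector_space_coord_space)
  have "subspace (coords n)"
    by (rule subspaceI) (auto simp: coords_def)
  then have "span (unit_vec ` {..<n}) \<subseteq> coords n"
    by (intro span_minimal) (auto simp: coords_def unit_vec_def)
  moreover have "x \<in> span (unit_vec ` {..<n})" if "x \<in> coords n" for x :: "nat \<Rightarrow> 'k"
  proof -
    have "(\<Sum>i<n. scale (coord_space n) (x i) (unit_vec i)) \<in> span (unit_vec ` {..<n})"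
      by (intro span_sum span_scale span_base) auto
    then show ?thesis using coords_eq_sum_unit_vec[OF that] by simp
  qed
  ultimately show ?thesis by auto
qed

lemma fin_dim_coord_space: "fin_dim_space (coord_space n :: ('k::field, nat \<Rightarrow> 'k) vspace)"
  unfolding fin_dim_space_def
  using vector_space_coord_space span_unit_vec
  by (intro conjI exI[of _ "unit_vec ` {..<n}"]) auto

text \<open>
  A model of the irreducible module: the action on binary forms of degree \<open>n - 1\<close>, in the basis of
  monomials. In contrast to the normalisation of a string, where the action of \<open>F\<close> has coefficients
  one and needs to be cut off at index \<open>n\<close>, the coefficient \<open>n - i\<close> here vanishes at \<open>i = n\<close> by itself.
\<close>

definition poly_act :: "nat \<Rightarrow> 'k::field_char_0 ^ 2 ^ 2 \<Rightarrow> (nat \<Rightarrow> 'k) \<Rightarrow> nat \<Rightarrow> 'k" where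
  "poly_act n s x i =
     s $ 1 $ 1 * (of_nat n - 1 - 2 * of_nat i) * x i +
     s $ 1 $ 2 * (of_nat i + 1) * x (Suc i) +
     s $ 2 $ 1 * (if i = 0 then 0 else (of_nat n - of_nat i) * x (i - 1))"

lemma poly_act_bracket:
  assumes s2: "s $ 2 $ 2 = - s $ 1 $ 1" and t2: "t $ 2 $ 2 = - t $ 1 $ 1"
  shows "poly_act n (brk sl2 s t) x = poly_act n s (poly_act n t x) - poly_act n t (poly_act n s x)"
    (is "?l = ?r")
proof
  have 0: "?l 0 = ?r 0"
    by (simp add: poly_act_def matrix2_simps s2 t2) algebra
  have 1: "?l (Suc 0) = ?r (Suc 0)"
    by (simp add: poly_act_def matrix2_simps s2 t2) algebra
  have 2: "?l (Suc (Suc j)) = ?r (Suc (Suc j))" for j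
    by (simp add: poly_act_def matrix2_simps s2 t2) algebra
  show "?l i = ?r i" for i
    using 0 1 2 by (metis not0_implies_Suc)
qed

lemma lie_module_poly_act:
  "lie_module sl2 (coord_space n :: ('k::field_char_0, nat \<Rightarrow> 'k) vspace) (poly_act n)"
  unfolding lie_module_def
proof (intro conjI ballI)
  fix s t :: "'k ^ 2 ^ 2" and x :: "nat \<Rightarrow> 'k"
  show "linear_between (coord_space n) (coord_space n) (poly_act n s)"
    unfolding linear_between_def
  proof (intro conjI ballI allI)
    fix x :: "nat \<Rightarrow> 'k" assume x: "x \<in> carrier (coord_space n)"
    show "poly_act n s x \<in> carrier (coord_space n)"
      unfolding coord_space_simps coords_def mem_Collect_eq
    proof (intro allI impI)
      fix i assume "n \<le> i"
      then show "poly_act n s x i = 0"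
        using x by (cases "i = n") (auto simp: coords_def poly_act_def)
    qed
  qed (auto simp: fun_eq_iff poly_act_def algebra_simps)
  show "linear_between sl2 (coord_space n) (\<lambda>s. poly_act n s x)" if "x \<in> carrier (coord_space n)" for x :: "nat \<Rightarrow> 'k"
    unfolding linear_between_def
  proof (intro conjI ballI allI)
    fix s :: "'k ^ 2 ^ 2"
    show "poly_act n s x \<in> carrier (coord_space n)"
      unfolding coord_space_simps coords_def mem_Collect_eq
    proof (intro allI impI)
      fix i assume "n \<le> i"
      then show "poly_act n s x i = 0"
        using that by (cases "i = n") (auto simp: coords_def poly_act_def)
    qed
  qed (auto simp: fun_eq_iff poly_act_def sl2_def algebra_simps)
  assume s: "s \<in> carrier sl2" and t: "t \<in> carrier sl2"
  have "s $ 2 $ 2 = - s $ 1 $ 1" "t $ 2 $ 2 = - t $ 1 $ 1"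
    using s t by (auto simp: matrix2_simps add_eq_0_iff)
  then show "poly_act n (brk sl2 s t) x = poly_act n s (poly_act n t x) - poly_act n t (poly_act n s x)"
    by (rule poly_act_bracket)
qed (rule lie_algebra_sl2 fin_dim_coord_space)+

text \<open>
  The kernel of \<open>E\<close> is the line through the first basis vector, which has weight \<open>n - 1\<close>. Hence the
  string contained in a nonzero stable subspace \<open>W\<close> has length \<open>n\<close>, and so it spans the whole space.
\<close>

lemma irreducible_poly_act:
  assumes "n \<ge> 1"
  shows "irreducible_module sl2 (coord_space n :: ('k::field_char_0, nat \<Rightarrow> 'k) vspace) (poly_act n)"
  unfolding irreducible_module_def
proof (intro conjI allI impI)
  interpret V: sl2_module "coord_space n :: ('k, nat \<Rightarrow> 'k) vspace" "poly_act n"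
    by unfold_locales (rule lie_module_poly_act)
  show "lie_module sl2 (coord_space n :: ('k, nat \<Rightarrow> 'k) vspace) (poly_act n)" by (rule V.mod)
  have "unit_vec 0 \<in> coords n" "unit_vec 0 \<noteq> (0 :: nat \<Rightarrow> 'k)"
    using assms by (auto simp: coords_def unit_vec_def fun_eq_iff)
  then show "carrier (coord_space n) \<noteq> {0 :: nat \<Rightarrow> 'k}" by auto
  fix W :: "(nat \<Rightarrow> 'k) set"
  assume "subspace_of (coord_space n) W \<and> stable sl2 (poly_act n) W"
  then have W: "subspace_of (coord_space n) W" "stable sl2 (poly_act n) W" by auto
  let ?W = "(coord_space n :: ('k, nat \<Rightarrow> 'k) vspace)\<lparr>carrier := W\<rparr>"
  interpret W: sl2_module ?W "poly_act n"
    by unfold_locales (rule lie_module_submodule[OF V.mod W])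
  have sub: "W \<subseteq> coords n" using W by (auto simp: subspace_of_def)
  show "W = {0} \<or> W = carrier (coord_space n)"
  proof (cases "W = {0}")
    case False
    then obtain v \<mu> where v: "v \<in> W" "v \<noteq> 0" "poly_act n sl2_E v = 0"
      and mu: "poly_act n sl2_H v = (\<lambda>i. \<mu> * v i)"
      using W.exists_highest_weight_vector by auto
    have "(of_nat i + 1) * v (Suc i) = 0" for i
      using fun_cong[OF v(3), of i] by (simp add: poly_act_def sl2_E_def)
    then have "v (Suc i) = 0" for i
      by (metis mult_eq_0_iff of_nat_Suc add.commute of_nat_neq_0)
    then have v0: "v 0 \<noteq> 0"
      using v(2) by (metis (full_types) ext not0_implies_Suc zero_fun_apply)
    then have mu': "\<mu> = of_nat n - 1"
      using fun_cong[OF mu, of 0] by (simp add: poly_act_def sl2_H_def)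
    obtain k where k: "\<mu> = of_nat k - 1" "hw_string ?W (poly_act n) k (\<lambda>i. (poly_act n sl2_F ^^ i) v)"
      using W.hw_string_of_highest_weight_vector[of v \<mu>] v mu by auto
    define w where "w = (\<lambda>i. (poly_act n sl2_F ^^ i) v)"
    have "k = n" using k(1) mu' by simp
    then have w: "hw_string ?W (poly_act n) n w" using k by (simp add: w_def)
    have wW: "w i \<in> W" for i using w by (simp add: hw_string_def)
    have ind: "V.seq_indep n w"
      using W.hw_string_indep[OF w] by (simp add: V.seq_indep_def W.seq_indep_def)
    have "x \<in> W" if x: "x \<in> coords n" for x
    proof -
      obtain c where "x = (\<Sum>i<n. scale (coord_space n) (c i) (w i))"
        using V.seq_indep_imp_span[OF ind, of "unit_vec ` {..<n}" x] wW sub x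
          card_image_le[of "{..<n}" "unit_vec :: nat \<Rightarrow> nat \<Rightarrow> 'k"]
        by (auto simp: span_unit_vec[unfolded coord_space_simps])
      then have "x = comb ?W n w c" by (simp add: comb_def)
      then show ?thesis using W.comb_carrier[OF w, of c] by simp
    qed
    then show ?thesis using sub by auto
  qed simp
qed

lemma irreducible_irr_act:
  assumes "n \<ge> 1"
  shows "irreducible_module sl2 (coord_space n :: ('k::field_char_0, nat \<Rightarrow> 'k) vspace) (irr_act n)"
  unfolding irr_act_def 
  by (rule someI[of "irreducible_module sl2 (coord_space n)", OF irreducible_poly_act[OF assms]])

lemma irr_alg_simps [simp]:
  "carrier (irr_alg n) = coords n" "scale (irr_alg n) = (\<lambda>c x i. c * x i)"
  "brk (irr_alg n) = (\<lambda>x y. 0)" "act (irr_alg n) = irr_act n"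
  by (simp_all add: irr_alg_def)

lemma fin_dim_irr_alg: "fin_dim_space (irr_alg n :: ('k::field_char_0, _, _) lie_s_alg)"
  using fin_dim_coord_space[of n] by (simp add: fin_dim_space_def)

lemma lie_module_irr_alg:
  assumes "n \<ge> 1" shows "lie_module sl2 (irr_alg n :: ('k::field_char_0, _, _) lie_s_alg) (irr_act n)"
  using irreducible_irr_act[OF assms, where ?'k = 'k] fin_dim_irr_alg[of n, where ?'k = 'k]
  unfolding irreducible_module_def lie_module_def by (simp add: linear_between_def)

lemma irr_alg_stable_subspace:
  assumes "n \<ge> 1" "subspace_of (irr_alg n :: ('k::field_char_0, _, _) lie_s_alg) W" "stable sl2 (irr_act n) W"
  shows "W = {0} \<or> W = coords n"
  using irreducible_irr_act[OF assms(1), where ?'k = 'k] assms(2,3)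
  unfolding irreducible_module_def subspace_of_def by simp

text \<open>
  The span of a string is stable, so it is everything by irreducibility; comparing dimensions shows
  that the length of the string is \<open>n\<close>. This is all that is needed about the chosen action
  \<^term>\<open>irr_act n\<close>.
\<close>

lemma irr_alg_hw_string:
  assumes "n \<ge> 1"
  obtains u where "hw_string (irr_alg n :: ('k::field_char_0, _, _) lie_s_alg) (irr_act n) n u"
    "comb (irr_alg n) n u ` coords n = coords n"
proof -
  interpret sl2_module "irr_alg n :: ('k, _, _) lie_s_alg" "irr_act n"
    by unfold_locales (rule lie_module_irr_alg[OF assms])
  have "carrier (irr_alg n) \<noteq> {0 :: nat \<Rightarrow> 'k}"
    using irreducible_irr_act[OF assms, where ?'k = 'k] by (simp add: irreducible_module_def)
  then obtain m u where m: "m \<ge> 1" and u: "hw_string (irr_alg n :: ('k, _, _) lie_s_alg) (irr_act n) m u"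
    using exists_hw_string by metis
  let ?I = "comb (irr_alg n) m u ` coords m"
  have sp: "span (unit_vec ` {..<n}) = coords n"
    using span_unit_vec[of n, where ?'k = 'k] by simp
  have "?I \<subseteq> coords n" using comb_carrier[OF u] by auto
  then have "subspace_of (irr_alg n) ?I"
    using comb_image_subspace[OF u] by (simp add: subspace_of_def)
  moreover have u_img: "u i \<in> ?I" if "i < m" for i
    using comb_unit_vec[OF that, of u] unit_vec_coords[OF that] by (metis imageI)
  moreover have "u 0 \<noteq> 0" using u m by (simp add: hw_string_def)
  ultimately have I: "?I = coords n"
    using irr_alg_stable_subspace[OF assms _ comb_image_stable[OF u]] m by fastforce
  have "m \<le> card (unit_vec ` {..<n} :: (nat \<Rightarrow> 'k) set)"
    using seq_indep_le_card[OF hw_string_indep[OF u], of "unit_vec ` {..<n}"] hw_string_carrier[OF u] sp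
    by simp
  then have "m \<le> n" using card_image_le[of "{..<n}" "unit_vec :: nat \<Rightarrow> nat \<Rightarrow> 'k"] by simp
  moreover have "n \<le> card (u ` {..<m})"
  proof (rule seq_indep_le_card)
    show "seq_indep n unit_vec"
      unfolding seq_indep_def
    proof (intro allI impI)
      fix c i assume c: "(\<Sum>i<n. scale (irr_alg n) (c i) (unit_vec i)) = (0 :: nat \<Rightarrow> 'k)" "i < n"
      have "0 = (\<Sum>j<n. c j * unit_vec j i)" using fun_cong[OF c(1), of i] by (simp add: sum_fun_apply)
      also have "\<dots> = (\<Sum>j<n. if j = i then c i else 0)" by (rule sum.cong) (auto simp: unit_vec_def)
      also have "\<dots> = c i" using c by simp
      finally show "c i = 0" by simp
    qed
    fix i assume "i < n"
    then have "unit_vec i \<in> ?I" unfolding I by (auto simp: coords_def unit_vec_def)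
    then obtain x where x: "unit_vec i = comb (irr_alg n) m u x" by blast
    show "unit_vec i \<in> span (u ` {..<m})"
      unfolding x comb_def by (intro span_sum span_scale span_base) auto
  qed simp
  then have "n \<le> m" using card_image_le[of "{..<m}" u] by simp
  ultimately show thesis using that u I by auto
qed

section \<open>Invariant bilinear forms\<close>

text \<open>
  In coordinates with respect to a string, this is up to a scalar the only invariant bilinear form:
  invariance under \<open>H\<close> pairs the \<open>i\<close>-th with the \<open>(n-1-i)\<close>-th vector, and invariance under \<open>F\<close> makes
  the values alternate in sign.
\<close>

definition string_form :: "nat \<Rightarrow> (nat \<Rightarrow> 'k::comm_ring_1) \<Rightarrow> (nat \<Rightarrow> 'k) \<Rightarrow> 'k" where
  "string_form n x y = (\<Sum>i<n. (-1) ^ i * x i * y (n - 1 - i))"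

lemma string_form_linear:
  "string_form n (x + x') y = string_form n x y + string_form n x' y"
  "string_form n x (y + y') = string_form n x y + string_form n x y'"
  "string_form n (\<lambda>i. c * x i) y = c * string_form n x y"
  "string_form n x (\<lambda>i. c * y i) = c * string_form n x y"
  by (simp_all add: string_form_def sum_distrib_left sum.distrib algebra_simps)

lemma string_form_unit_vec:
  assumes "n \<ge> 1" shows "string_form n (unit_vec 0) (unit_vec (n - 1)) = (1 :: 'k::field)"
proof -
  have "string_form n (unit_vec 0) (unit_vec (n - 1)) = (\<Sum>i<n. if i = 0 then (1 :: 'k) else 0)"
    unfolding string_form_def by (rule sum.cong) (auto simp: unit_vec_def)
  then show ?thesis using assms by simp
qed

text \<open>Reversing the order of summation changes the sign when \<open>n\<close> is even.\<close>

lemma string_form_alternating: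
  assumes "even n" shows "string_form n x x = (0 :: 'k::field_char_0)"
proof -
  have "string_form n x x = (\<Sum>i<n. (-1) ^ (n - Suc i) * x (n - Suc i) * x (n - 1 - (n - Suc i)))"
    unfolding string_form_def by (rule sum.nat_diff_reindex[symmetric])
  also have "\<dots> = (\<Sum>i<n. - ((-1) ^ i * x i * x (n - 1 - i)))"
  proof (rule sum.cong)
    fix i assume "i \<in> {..<n}"
    then have "(-1) ^ i * (-1) ^ (n - Suc i) = (-1 :: 'k)"
      using assms by (simp add: power_add[symmetric])
    then have "(-1) ^ (n - Suc i) = - ((-1 :: 'k) ^ i)"
      by (cases "even i") auto
    moreover have "n - 1 - (n - Suc i) = i" using \<open>i \<in> {..<n}\<close> by auto
    ultimately show "(-1) ^ (n - Suc i) * x (n - Suc i) * x (n - 1 - (n - Suc i))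
      = - ((-1) ^ i * x i * x (n - 1 - i))" by simp
  qed simp
  also have "\<dots> = - string_form n x x" by (simp add: sum_negf string_form_def)
  finally show ?thesis by (simp add: eq_neg_iff_add_eq_0 flip: mult_2)
qed

text \<open>
  The \<open>H\<close>-part cancels term by term. In the \<open>F\<close>- and \<open>E\<close>-parts the two sums cancel after a shift of the
  summation index by one.
\<close>

lemma string_form_invariant:
  "string_form n (str_act n s x) y + string_form n x (str_act n s y) = 0"
proof (cases n)
  case (Suc m)
  let ?h = "\<lambda>i. of_nat n - 1 - 2 * of_nat i :: 'a"
  define X where "X x i = (if i = 0 then 0 else x (i - 1))" for x :: "nat \<Rightarrow> 'a" and i :: nat
  define Y where "Y x i = of_nat (Suc i) * (of_nat n - 1 - of_nat i) * x (Suc i)" for x :: "nat \<Rightarrow> 'a" and i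
  have H: "(\<Sum>i<n. (-1) ^ i * (?h i * x i) * y (n - 1 - i)) +
      (\<Sum>i<n. (-1) ^ i * x i * (?h (n - 1 - i) * y (n - 1 - i))) = 0"
    unfolding sum.distrib[symmetric]
    by (rule sum.neutral) (auto simp: of_nat_diff algebra_simps)
  have F: "(\<Sum>i<n. (-1) ^ i * X x i * y (n - 1 - i)) + (\<Sum>i<n. (-1) ^ i * x i * X y (n - 1 - i)) = 0"
  proof -
    have "(\<Sum>i<n. (-1) ^ i * X x i * y (n - 1 - i)) = (\<Sum>i<m. - ((-1) ^ i * x i * y (m - Suc i)))"
      unfolding Suc sum.lessThan_Suc_shift by (simp add: X_def)
    also have "\<dots> = - (\<Sum>i<m. (-1) ^ i * x i * X y (m - i))"
      unfolding sum_negf by (intro arg_cong[where f = uminus] sum.cong) (auto simp: X_def)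
    also have "(\<Sum>i<m. (-1) ^ i * x i * X y (m - i)) = (\<Sum>i<n. (-1) ^ i * x i * X y (n - 1 - i))"
      by (simp add: Suc X_def)
    finally show ?thesis by simp
  qed
  have E: "(\<Sum>i<n. (-1) ^ i * Y x i * y (n - 1 - i)) + (\<Sum>i<n. (-1) ^ i * x i * Y y (n - 1 - i)) = 0"
  proof -
    have "(\<Sum>i<n. (-1) ^ i * x i * Y y (n - 1 - i)) = (\<Sum>i<m. - ((-1) ^ i * x (Suc i) * Y y (m - Suc i)))"
      unfolding Suc sum.lessThan_Suc_shift by (simp add: Y_def Suc)
    also have "\<dots> = (\<Sum>i<m. - ((-1) ^ i * Y x i * y (m - i)))"
    proof (rule sum.cong)
      fix i assume "i \<in> {..<m}"
      then have "Suc (m - Suc i) = m - i" "i < m" by auto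
      then show "- ((-1) ^ i * x (Suc i) * Y y (m - Suc i)) = - ((-1) ^ i * Y x i * y (m - i))"
        by (simp add: Y_def Suc of_nat_diff algebra_simps)
    qed simp
    also have "\<dots> = - (\<Sum>i<n. (-1) ^ i * Y x i * y (n - 1 - i))"
      by (simp add: Suc sum_negf Y_def)
    finally show ?thesis by simp
  qed
  have sa: "str_act n s z i = s $ 1 $ 1 * (?h i * z i) + s $ 1 $ 2 * Y z i + s $ 2 $ 1 * X z i"
    if "i < n" for i z
    using that by (simp add: str_act_def X_def Y_def mult.assoc)
  have "string_form n (str_act n s x) y + string_form n x (str_act n s y)
    = s $ 1 $ 1 * ((\<Sum>i<n. (-1) ^ i * (?h i * x i) * y (n - 1 - i)) +
        (\<Sum>i<n. (-1) ^ i * x i * (?h (n - 1 - i) * y (n - 1 - i))))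
    + s $ 1 $ 2 * ((\<Sum>i<n. (-1) ^ i * Y x i * y (n - 1 - i)) + (\<Sum>i<n. (-1) ^ i * x i * Y y (n - 1 - i)))
    + s $ 2 $ 1 * ((\<Sum>i<n. (-1) ^ i * X x i * y (n - 1 - i)) + (\<Sum>i<n. (-1) ^ i * x i * X y (n - 1 - i)))"
    unfolding string_form_def sum_distrib_left sum.distrib[symmetric]
    by (rule sum.cong) (simp_all add: sa algebra_simps)
  then show ?thesis unfolding H E F by simp
qed (simp add: string_form_def)

context sl2_module
begin

context
  fixes n w and Z :: "('k, 'b::ab_group_add, 'p) vspace_scheme" and \<beta> :: "'a \<Rightarrow> 'a \<Rightarrow> 'b"
  assumes w: "hw_string V \<rho> n w" and Z: "fin_dim_space Z"
    and lin1: "\<And>x. x \<in> carrier V \<Longrightarrow> linear_between V Z (\<beta> x)"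
    and lin2: "\<And>y. y \<in> carrier V \<Longrightarrow> linear_between V Z (\<lambda>x. \<beta> x y)"
    and inv: "\<And>s x y. s \<in> carrier sl2 \<Longrightarrow> x \<in> carrier V \<Longrightarrow> y \<in> carrier V \<Longrightarrow> \<beta> (\<rho> s x) y + \<beta> x (\<rho> s y) = 0"
begin

text \<open>
  In this context \<open>\<beta>\<close> takes values in a vector space \<open>Z\<close>, viewed as a trivial module. Scalar forms are
  needed to analyse the form chosen for the Heisenberg algebras, and vector-valued ones to analyse
  the bracket of an unknown algebra.
\<close>

lemma invariant_form_on_string:
  assumes "i < n" "j < n"
  shows "\<beta> (w i) (w j) = (if i + j = n - 1 then scale Z ((-1) ^ i) (\<beta> (w 0) (w (n - 1))) else 0)"
proof -
  interpret Z: fd_space Z by unfold_locales (rule Z)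
  have w': "w i \<in> carrier V" "F (w i) = w (Suc i)"
    "H (w i) = scale V (of_nat n - 1 - 2 * of_nat i) (w i)" for i
    using w unfolding hw_string_def by blast+
  have shift: "\<beta> (w (Suc i)) (w j) = - \<beta> (w i) (w (Suc j))" for i j
    using inv[OF EFH_carrier(2) w'(1)[of i] w'(1)[of j]]
    unfolding w'(2) by (simp only: eq_neg_iff_add_eq_0)
  show ?thesis
  proof (cases "i + j = n - 1")
    case True
    have "i + j = n - 1 \<Longrightarrow> \<beta> (w i) (w j) = scale Z ((-1) ^ i) (\<beta> (w 0) (w (n - 1)))" for i j
    proof (induction i arbitrary: j)
      case (Suc i)
      then have "\<beta> (w i) (w (Suc j)) = scale Z ((-1) ^ i) (\<beta> (w 0) (w (n - 1)))" by simp
      then show ?case unfolding shift by simp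
    qed simp
    from this[OF True] show ?thesis unfolding if_P[OF True] .
  next
    case False
    have "scale Z (of_nat n - 1 - 2 * of_nat i) (\<beta> (w i) (w j)) + scale Z (of_nat n - 1 - 2 * of_nat j) (\<beta> (w i) (w j)) = 0"
    proof -
      have "\<beta> (scale V c (w i)) (w j) = scale Z c (\<beta> (w i) (w j))"
        "\<beta> (w i) (scale V c (w j)) = scale Z c (\<beta> (w i) (w j))" for c
        using lin1[OF w'(1)[of i]] lin2[OF w'(1)[of j]] w'(1) unfolding linear_between_def by blast+
      then show ?thesis
        using inv[OF EFH_carrier(3) w'(1)[of i] w'(1)[of j]] unfolding w'(3) by simp
    qed
    moreover have "(of_nat n - 1 - 2 * of_nat i) + (of_nat n - 1 - 2 * of_nat j)
      = (2 * (of_nat n - 1 - of_nat i - of_nat j) :: 'k)"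
      by (simp add: algebra_simps)
    ultimately have "scale Z (2 * (of_nat n - 1 - of_nat i - of_nat j)) (\<beta> (w i) (w j)) = 0"
      by (simp only: Z.scale_left_distrib[symmetric])
    moreover have "of_nat n - 1 - of_nat i - of_nat j \<noteq> (0 :: 'k)"
    proof
      assume z: "of_nat n - 1 - of_nat i - of_nat j = (0 :: 'k)"
      have "(of_nat n :: 'k) = (of_nat n - 1 - of_nat i - of_nat j) + of_nat (Suc (i + j))" by simp
      then have "(of_nat n :: 'k) = of_nat (Suc (i + j))" unfolding z by simp
      then have "n = Suc (i + j)" unfolding of_nat_eq_iff .
      then show False using False by simp
    qed
    ultimately have "\<beta> (w i) (w j) = 0"
      by (metis Z.scale_eq_0_iff mult_eq_0_iff zero_neq_numeral)
    then show ?thesis unfolding if_not_P[OF False] .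
  qed
qed

lemma invariant_form_eq_string_form:
  "\<beta> (comb V n w x) (comb V n w y) = scale Z (string_form n x y) (\<beta> (w 0) (w (n - 1)))"
proof -
  interpret Z: fd_space Z by unfold_locales (rule Z)
  note wc = hw_string_carrier[OF w]
  have "\<beta> (comb V n w x) (comb V n w y) = comb Z n (\<lambda>i. \<beta> (w i) (comb V n w y)) x"
    by (rule linear_between_comb[OF fin_dim Z lin2]) (simp_all add: comb_def wc)
  also have "\<dots> = (\<Sum>i<n. scale Z (x i) (\<Sum>j<n. scale Z (y j) (\<beta> (w i) (w j))))"
  proof -
    have "\<beta> (w i) (comb V n w y) = comb Z n (\<lambda>j. \<beta> (w i) (w j)) y" for i
      by (rule linear_between_comb[OF fin_dim Z lin1]) (simp_all add: wc)
    then show ?thesis by (simp add: comb_def)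
  qed
  also have "\<dots> = (\<Sum>i<n. scale Z ((-1) ^ i * x i * y (n - 1 - i)) (\<beta> (w 0) (w (n - 1))))"
  proof (rule sum.cong)
    fix i assume i: "i \<in> {..<n}"
    have "(\<Sum>j<n. scale Z (y j) (\<beta> (w i) (w j)))
      = (\<Sum>j<n. if j = n - 1 - i then scale Z (y (n - 1 - i)) (scale Z ((-1) ^ i) (\<beta> (w 0) (w (n - 1)))) else 0)"
    proof (rule sum.cong)
      fix j assume "j \<in> {..<n}"
      then show "scale Z (y j) (\<beta> (w i) (w j)) =
          (if j = n - 1 - i then scale Z (y (n - 1 - i)) (scale Z ((-1) ^ i) (\<beta> (w 0) (w (n - 1)))) else 0)"
        using i by (subst invariant_form_on_string) auto
    qed simp
    also have "\<dots> = scale Z (y (n - 1 - i)) (scale Z ((-1) ^ i) (\<beta> (w 0) (w (n - 1))))"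
      using i by simp
    finally show "scale Z (x i) (\<Sum>j<n. scale Z (y j) (\<beta> (w i) (w j)))
      = scale Z ((-1) ^ i * x i * y (n - 1 - i)) (\<beta> (w 0) (w (n - 1)))"
      by (simp add: ac_simps)
  qed simp
  finally show ?thesis by (simp add: string_form_def Z.scale_sum_left)
qed

lemma even_if_invariant_form_alternating:
  assumes n: "n \<ge> 1" and nz: "\<beta> (w 0) (w (n - 1)) \<noteq> 0"
    and alt: "\<And>x y. x \<in> carrier V \<Longrightarrow> y \<in> carrier V \<Longrightarrow> \<beta> x y = - \<beta> y x"
  shows "even n"
proof (rule ccontr)
  interpret Z: fd_space Z by unfold_locales (rule Z)
  assume "odd n"
  then have "\<beta> (w (n - 1)) (w 0) = \<beta> (w 0) (w (n - 1))"
    using invariant_form_on_string[of "n - 1" 0] n by simp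
  then have "\<beta> (w 0) (w (n - 1)) = - \<beta> (w 0) (w (n - 1))"
    using alt hw_string_carrier[OF w] by metis
  then have "scale Z 2 (\<beta> (w 0) (w (n - 1))) = 0"
    using Z.scale_left_distrib[of 1 1] by (simp add: eq_neg_iff_add_eq_0)
  then show False using nz by simp
qed

end

end

section \<open>The abelian algebras\<close>

lemma zero_sumset:
  fixes X :: "'a::comm_monoid_add set"
  shows "{w + w' |w w'. w \<in> {0} \<and> w' \<in> X} = X" "{w + w' |w w'. w \<in> X \<and> w' \<in> {0}} = X"
  by auto

text \<open>
  The zero subspace is a subalgebra, so it is generated by the commutators \<open>[s, x]\<close> once they all
  vanish. Minimality thus becomes a statement about trivial actions.
\<close>

lemma act_subalgebra_eq_zero_iff:
  assumes N: "lie_s_algebra S N" and M: "M \<subseteq> carrier N"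
  shows "act_subalgebra S N M = {0} \<longleftrightarrow> (\<forall>s\<in>carrier S. \<forall>x\<in>M. act N s x = 0)"
proof -
  interpret fd_space N using N by unfold_locales (simp add: lie_s_algebra_def lie_algebra_def)
  let ?X = "{act N s x |s x. s \<in> carrier S \<and> x \<in> M}"
  have "brk N 0 0 = 0" using N carrier_zero unfolding lie_s_algebra_def lie_algebra_def by blast
  then have z: "lie_subalgebra N {0}"
    by (simp add: lie_subalgebra_def subspace_of_def subspace_0 subspace_def)
  have X: "?X \<subseteq> generated_subalgebra N ?X" unfolding generated_subalgebra_def by blast
  have "0 \<in> generated_subalgebra N ?X"
    unfolding generated_subalgebra_def lie_subalgebra_def subspace_of_def using subspace_0 by blast
  moreover have "generated_subalgebra N ?X \<subseteq> {0}" if "?X \<subseteq> {0}"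
    using z that unfolding generated_subalgebra_def by blast
  ultimately show ?thesis using X unfolding act_subalgebra_def by blast
qed

lemma irr_act_nontrivial:
  assumes "n \<ge> 2"
  shows "\<exists>x\<in>coords n. irr_act n sl2_F x \<noteq> (0 :: nat \<Rightarrow> 'k::field_char_0)"
proof -
  obtain u where u: "hw_string (irr_alg n :: ('k, _, _) lie_s_alg) (irr_act n) n u"
    using irr_alg_hw_string[of n] assms by (metis One_nat_def Suc_1 Suc_leD)
  then have "irr_act n sl2_F (u 0) = u 1" "u 1 \<noteq> 0" "u 0 \<in> coords n"
    using assms by (auto simp: hw_string_def)
  then show ?thesis by auto
qed

lemma lie_s_algebra_irr_alg:
  assumes "n \<ge> 1"
  shows "lie_s_algebra sl2 (irr_alg n :: ('k::field_char_0, _, _) lie_s_alg)"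
proof -
  let ?V = "irr_alg n :: ('k, _, _) lie_s_alg"
  interpret sl2_module ?V "irr_act n"
    by unfold_locales (rule lie_module_irr_alg[OF assms])
  have "completely_reducible sl2 ?V (irr_act n)"
    unfolding completely_reducible_def
  proof (intro allI impI)
    fix W assume W: "subspace_of ?V W \<and> stable sl2 (irr_act n) W"
    have "subspace {0}" by (rule subspaceI) auto
    then have triv: "subspace_of ?V {0}" "stable sl2 (irr_act n :: 'k ^ 2 ^ 2 \<Rightarrow> _) {0}"
      "subspace_of ?V (coords n)" "stable sl2 (irr_act n :: 'k ^ 2 ^ 2 \<Rightarrow> _) (coords n)"
      using subspace_carrier carrier_zero act_carrier
      by (auto simp: subspace_of_def stable_def act_zero)
    have "0 \<in> W" using W subspace_0 by (auto simp: subspace_of_def)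
    consider "W = {0}" | "W = coords n" using irr_alg_stable_subspace[OF assms] W by blast
    then show "\<exists>W'. subspace_of ?V W' \<and> stable sl2 (irr_act n) W' \<and> W \<inter> W' = {0} \<and>
        {w + w' |w w'. w \<in> W \<and> w' \<in> W'} = carrier ?V"
    proof cases
      case 1
      then show ?thesis using triv carrier_zero by (intro exI[of _ "coords n"]) auto
    next
      case 2
      then show ?thesis using triv \<open>0 \<in> W\<close> by (intro exI[of _ "{0}"]) auto
    qed
  qed
  then show ?thesis
    unfolding lie_s_algebra_def lie_algebra_def derivation_def
    using fin_dim mod lin_act carrier_zero by (auto simp: linear_between_def act_zero)
qed

lemma minimal_irr_alg:
  assumes "n \<ge> 2"
  shows "minimal_lie_s_algebra sl2 (irr_alg n :: ('k::field_char_0, _, _) lie_s_alg)"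
proof -
  let ?V = "irr_alg n :: ('k, _, _) lie_s_alg"
  have n: "n \<ge> 1" using assms by simp
  note lsa = lie_s_algebra_irr_alg[OF n, where ?'k = 'k]
  interpret sl2_module ?V "irr_act n" by unfold_locales (rule lie_module_irr_alg[OF n])
  have "act_subalgebra sl2 ?V (carrier ?V) \<noteq> {0}"
    using irr_act_nontrivial[OF assms, where ?'k = 'k] EFH_carrier(2)
    unfolding act_subalgebra_eq_zero_iff[OF lsa order_refl] by force
  moreover have "M = carrier ?V \<or> act_subalgebra sl2 ?V M = {0}"
    if "lie_subalgebra ?V M \<and> stable sl2 (act ?V) M" for M
  proof -
    have sub: "subspace_of ?V M" "stable sl2 (irr_act n :: 'k ^ 2 ^ 2 \<Rightarrow> _) M"
      using that by (auto simp: lie_subalgebra_def)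
    then have "M \<subseteq> carrier ?V" by (simp add: subspace_of_def)
    then show ?thesis
      using irr_alg_stable_subspace[OF n sub] unfolding act_subalgebra_eq_zero_iff[OF lsa \<open>M \<subseteq> carrier ?V\<close>]
      by (auto simp: act_zero)
  qed
  ultimately show ?thesis using lsa unfolding minimal_lie_s_algebra_def by blast
qed

lemma solvable_irr_alg:
  "solvable (irr_alg n :: ('k::field_char_0, _, _) lie_s_alg)"
proof -
  let ?V = "irr_alg n :: ('k, _, _) lie_s_alg"
  interpret fd_space ?V by unfold_locales (rule fin_dim_irr_alg)
  have "0 \<in> carrier ?V" by simp
  then have "{brk ?V x y |x y. x \<in> derived_series ?V 0 \<and> y \<in> derived_series ?V 0} = {0}"
    by (auto intro!: exI[of _ 0])
  then have "derived_series ?V (Suc 0) = span {0}" by (simp only: derived_series.simps)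
  then show ?thesis unfolding solvable_def span_insert_0 span_empty by blast
qed

section \<open>The Heisenberg algebras\<close>

text \<open>
  The conditions by which the form is chosen are satisfiable: the module is spanned by a string of
  even length \<open>2 m\<close>, so that the standard form in its coordinates is alternating.
\<close>

lemma heis_form:
  assumes "m \<ge> 1"
  defines "V \<equiv> irr_alg (2 * m) :: ('k::field_char_0, _, _) lie_s_alg"
  shows "alternating_form V (heis_form m) \<and> invariant_form sl2 V (heis_form m) \<and>
    (\<exists>x\<in>carrier V. \<exists>y\<in>carrier V. heis_form m x y \<noteq> 0)"
proof -
  let ?n = "2 * m"
  have n: "?n \<ge> 1" using assms by simp
  interpret sl2_module V "irr_act ?n"
    unfolding V_def by unfold_locales (rule lie_module_irr_alg[OF n])
  obtain u where u: "hw_string V (irr_act ?n) ?n u" and surj: "comb V ?n u ` coords ?n = coords ?n"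
    unfolding V_def using irr_alg_hw_string[OF n] by blast
  have V: "carrier V = coords ?n" "scale V = (\<lambda>c x i. c * x i)" "act V = irr_act ?n"
    by (simp_all add: V_def)
  define g where "g = inv_into (coords ?n) (comb V ?n u)"
  have g: "g x \<in> coords ?n" "comb V ?n u (g x) = x" if "x \<in> coords ?n" for x
    using that surj inv_into_into[of x "comb V ?n u" "coords ?n"] f_inv_into_f[of x "comb V ?n u" "coords ?n"]
    by (auto simp: g_def)
  have gI: "g y = a" if "a \<in> coords ?n" "comb V ?n u a = y" for a y
  proof -
    have "y \<in> coords ?n" using that surj by blast
    then show ?thesis using comb_inj[OF u] g that by metis
  qed
  have g_add: "g (x + y) = g x + g y" if "x \<in> coords ?n" "y \<in> coords ?n" for x y
    by (rule gI) (simp_all add: comb_add coords_closed g that)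
  have g_scale: "g (\<lambda>i. c * x i) = (\<lambda>i. c * g x i)" if "x \<in> coords ?n" for x c
    by (rule gI) (simp_all add: comb_scale coords_closed g that V)
  have g_act: "g (irr_act ?n s x) = str_act ?n s (g x)" if "x \<in> coords ?n" "s \<in> carrier sl2" for x s
    by (rule gI) (use act_comb[OF u that(2), symmetric] g that in \<open>simp_all add: str_act_coords\<close>)
  define \<phi> where "\<phi> = (\<lambda>x y. string_form ?n (g x) (g y))"
  have "alternating_form V \<phi>"
    unfolding alternating_form_def linear_between_def \<phi>_def V
    by (auto simp: g_add g_scale string_form_linear string_form_alternating)
  moreover have "invariant_form sl2 V \<phi>"
    unfolding invariant_form_def \<phi>_def V
    by (auto simp: g_act string_form_invariant)
  moreover have "\<exists>x\<in>carrier V. \<exists>y\<in>carrier V. \<phi> x y \<noteq> 0"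
  proof -
    have c: "unit_vec 0 \<in> coords ?n" "unit_vec (?n - 1) \<in> coords ?n"
      using n by (auto simp: coords_def unit_vec_def)
    have "\<phi> (comb V ?n u (unit_vec 0)) (comb V ?n u (unit_vec (?n - 1))) = 1"
      unfolding \<phi>_def gI[OF c(1) refl] gI[OF c(2) refl] by (rule string_form_unit_vec[OF n])
    then show ?thesis using comb_carrier[OF u] zero_neq_one by metis
  qed
  ultimately have "\<exists>\<phi>. alternating_form V \<phi> \<and> invariant_form sl2 V \<phi> \<and>
      (\<exists>x\<in>carrier V. \<exists>y\<in>carrier V. \<phi> x y \<noteq> 0)" by blast
  then show ?thesis
    unfolding heis_form_def V_def[symmetric] by (rule someI_ex)
qed

lemma fin_dim_field: "fin_dim_space (\<lparr>carrier = UNIV, scale = (*)\<rparr> :: ('k::field, 'k) vspace)"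
proof -
  have "x \<in> module.span (*) {1}" for x :: 'k
    using vector_space_over_itself.span_scale[OF vector_space_over_itself.span_base[of 1 "{1}"], of x]
    by simp
  then show ?thesis
    unfolding fin_dim_space_def
    using vector_space_over_itself.vector_space_axioms by (auto intro!: exI[of _ "{1}"])
qed

lemma heis_form_on_string:
  assumes m: "m \<ge> 1"
  defines "V \<equiv> irr_alg (2 * m) :: ('k::field_char_0, _, _) lie_s_alg"
  assumes u: "hw_string V (irr_act (2 * m)) (2 * m) u"
    and surj: "comb V (2 * m) u ` coords (2 * m) = coords (2 * m)"
  shows "heis_form m (comb V (2 * m) u x) (comb V (2 * m) u y)
      = string_form (2 * m) x y * heis_form m (u 0) (u (2 * m - 1))"
    and "heis_form m (u 0) (u (2 * m - 1)) \<noteq> 0"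
proof -
  have n: "2 * m \<ge> 1" using m by simp
  interpret sl2_module V "irr_act (2 * m)"
    unfolding V_def by unfold_locales (rule lie_module_irr_alg[OF n])
  have V: "carrier V = coords (2 * m)" "act V = irr_act (2 * m)" by (simp_all add: V_def)
  note hf = heis_form[OF m, where ?'k = 'k, folded V_def]
  show eq: "heis_form m (comb V (2 * m) u x) (comb V (2 * m) u y)
      = string_form (2 * m) x y * heis_form m (u 0) (u (2 * m - 1))" for x y
    using invariant_form_eq_string_form[OF u fin_dim_field, of "heis_form m" x y] hf
    by (simp add: alternating_form_def invariant_form_def V)
  obtain a b where ab: "a \<in> coords (2 * m)" "b \<in> coords (2 * m)" "heis_form m a b \<noteq> (0 :: 'k)"
    using hf unfolding V(1) by blast
  obtain x y where "a = comb V (2 * m) u x" "b = comb V (2 * m) u y" using ab surj by blast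
  then show "heis_form m (u 0) (u (2 * m - 1)) \<noteq> 0" using eq[of x y] ab by auto
qed

lemma heis_alg_simps:
  "carrier (heis_alg m) = coords (2 * m) \<times> UNIV"
  "scale (heis_alg m) = (\<lambda>c p. ((\<lambda>i. c * fst p i), c * snd p))"
  "brk (heis_alg m) = (\<lambda>p q. (0, heis_form m (fst p) (fst q)))"
  "act (heis_alg m) = (\<lambda>s p. (irr_act (2 * m) s (fst p), 0))"
  by (simp_all add: heis_alg_def fun_eq_iff split_beta)

lemma fin_dim_heis_alg: "fin_dim_space (heis_alg m :: ('k::field_char_0, _, _) lie_s_alg)"
proof -
  let ?N = "heis_alg m :: ('k, _, _) lie_s_alg"
  interpret V: fd_space "irr_alg (2 * m) :: ('k, _, _) lie_s_alg"
    by unfold_locales (rule fin_dim_irr_alg)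
  interpret vector_space "scale ?N"
    by unfold_locales (simp_all add: heis_alg_simps prod_eq_iff fun_eq_iff algebra_simps)
  obtain B where B: "finite B" "V.span B = coords (2 * m)"
    using V.fin_dim by (auto simp: fin_dim_space_def)
  let ?B = "insert (0, 1) ((\<lambda>x. (x, 0)) ` B)"
  have "subspace (carrier ?N)"
    by (rule subspaceI) (auto simp: heis_alg_simps coords_def zero_prod_def)
  moreover have "B \<subseteq> coords (2 * m)" using B V.span_superset by blast
  ultimately have "span ?B \<subseteq> carrier ?N"
    by (intro span_minimal) (auto simp: heis_alg_simps coords_def)
  moreover have "(x, a) \<in> span ?B" if x: "x \<in> coords (2 * m)" for x a
  proof -
    have "V.subspace {x. (x, 0) \<in> span ?B}"
    proof (rule V.subspaceI)
      show "0 \<in> {x. (x, 0) \<in> span ?B}" using span_zero[of ?B] by (simp add: zero_prod_def)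
    next
      fix x y assume "x \<in> {x. (x, 0) \<in> span ?B}" "y \<in> {x. (x, 0) \<in> span ?B}"
      then show "x + y \<in> {x. (x, 0) \<in> span ?B}"
        using span_add[of "(x, 0)" ?B "(y, 0)"] by simp
    next
      fix c x assume "x \<in> {x. (x, 0) \<in> span ?B}"
      then show "scale (irr_alg (2 * m)) c x \<in> {x. (x, 0) \<in> span ?B}"
        using span_scale[of "(x, 0)" ?B c] by (simp add: heis_alg_simps)
    qed
    then have "V.span B \<subseteq> {x. (x, 0) \<in> span ?B}"
      by (intro V.span_minimal) (auto intro: span_base)
    then have "(x, 0) \<in> span ?B" using x B by auto
    moreover have "scale ?N a (0, 1) \<in> span ?B" by (intro span_scale span_base) simp
    then have "(0, a) \<in> span ?B" by (simp add: heis_alg_simps zero_fun_def)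
    ultimately show ?thesis using span_add[of "(x, 0)" ?B "(0, a)"] by simp
  qed
  then have "carrier ?N \<subseteq> span ?B" by (auto simp: heis_alg_simps)
  ultimately show ?thesis
    unfolding fin_dim_space_def using vector_space_axioms B by (intro conjI exI[of _ ?B]) auto
qed

lemma solvable_heis_alg:
  assumes m: "m \<ge> 1" shows "solvable (heis_alg m :: ('k::field_char_0, _, _) lie_s_alg)"
proof -
  let ?N = "heis_alg m :: ('k, _, _) lie_s_alg"
  interpret fd_space ?N by unfold_locales (rule fin_dim_heis_alg)
  have "heis_form m 0 0 = (0 :: 'k)"
    using heis_form[OF m, where ?'k = 'k] by (auto simp: alternating_form_def coords_def)
  moreover have "subspace ({0} \<times> UNIV)"
    by (rule subspaceI) (auto simp: heis_alg_simps zero_fun_def zero_prod_def)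
  then have "derived_series ?N (Suc 0) \<subseteq> {0} \<times> UNIV"
    unfolding derived_series.simps
    by (rule span_minimal[rotated]) (auto simp: heis_alg_simps)
  ultimately have "{brk ?N x y |x y. x \<in> derived_series ?N (Suc 0) \<and> y \<in> derived_series ?N (Suc 0)} \<subseteq> {0}"
    by (auto simp: heis_alg_simps zero_prod_def)
  then have "derived_series ?N (Suc (Suc 0)) \<subseteq> {0}"
    unfolding derived_series.simps(2)[of ?N "Suc 0"]
    by (intro span_minimal) (auto simp: subspace_def)
  moreover have "0 \<in> derived_series ?N (Suc (Suc 0))"
    unfolding derived_series.simps(2)[of ?N "Suc 0"] by (rule span_zero)
  ultimately show ?thesis unfolding solvable_def by blast
qed

lemma lie_module_heis_alg:
  assumes m: "m \<ge> 1"
  shows "lie_module sl2 (heis_alg m :: ('k::field_char_0, _, _) lie_s_alg) (act (heis_alg m))"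
proof -
  have n: "2 * m \<ge> 1" using m by simp
  show ?thesis
    using lie_module_irr_alg[OF n, where ?'k = 'k] fin_dim_heis_alg[of m, where ?'k = 'k]
    unfolding lie_module_def linear_between_def
    by (auto simp: heis_alg_simps zero_prod_def)
qed

text \<open>
  The set \<open>U\<close> of all \<open>x\<close> with \<open>(x, 0)\<close> in \<open>W\<close> is a stable subspace of the irreducible module. If it is
  zero, then every \<open>(x, a)\<close> in \<open>W\<close> satisfies \<open>[s, x] = 0\<close> for all \<open>s\<close>, because \<open>[s, (x, a)] = ([s, x], 0)\<close>.
  The invariants of a nontrivial irreducible module being zero, \<open>x\<close> vanishes.
\<close>

lemma heis_alg_stable_subspace:
  assumes m: "m \<ge> 1" and W: "subspace_of (heis_alg m :: ('k::field_char_0, _, _) lie_s_alg) W"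
    and st: "stable sl2 (act (heis_alg m)) W"
  shows "coords (2 * m) \<times> {0} \<subseteq> W \<or> W \<subseteq> {0} \<times> UNIV"
proof -
  let ?V = "irr_alg (2 * m) :: ('k, _, _) lie_s_alg"
  have n: "2 * m \<ge> 1" using m by simp
  interpret V: sl2_module ?V "irr_act (2 * m)" by unfold_locales (rule lie_module_irr_alg[OF n])
  interpret fd_space "heis_alg m :: ('k, _, _) lie_s_alg" by unfold_locales (rule fin_dim_heis_alg)
  have sub: "subspace W" "W \<subseteq> coords (2 * m) \<times> UNIV"
    using W by (auto simp: subspace_of_def heis_alg_simps)
  have stW: "(irr_act (2 * m) s x, 0) \<in> W" if "(x, a) \<in> W" "s \<in> carrier sl2" for x a s
    using st that unfolding stable_def heis_alg_simps by fastforce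
  define U where "U = {x. (x, 0) \<in> W}"
  have "V.subspace U"
  proof (rule V.subspaceI)
    show "0 \<in> U" using subspace_0[OF sub(1)] by (simp add: U_def zero_prod_def)
  next
    fix x y assume "x \<in> U" "y \<in> U"
    then show "x + y \<in> U" using subspace_add[OF sub(1), of "(x, 0)" "(y, 0)"] by (simp add: U_def)
  next
    fix c x assume "x \<in> U"
    then show "scale ?V c x \<in> U"
      using subspace_scale[OF sub(1), of "(x, 0)" c] by (simp add: U_def heis_alg_simps)
  qed
  moreover have "stable sl2 (irr_act (2 * m)) U" using stW by (auto simp: stable_def U_def)
  ultimately consider "U = {0}" | "U = coords (2 * m)"
    using irr_alg_stable_subspace[OF n, of U] sub by (auto simp: subspace_of_def U_def)
  then show ?thesis
  proof cases
    case 1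
    \<comment> \<open>The invariants form a stable subspace of the irreducible module, which is proper.\<close>
    define I where "I = {x \<in> coords (2 * m). \<forall>s\<in>carrier sl2. irr_act (2 * m) s x = (0 :: nat \<Rightarrow> 'k)}"
    have "V.subspace I"
      using V.subspace_invariants by (simp add: I_def)
    moreover have "stable sl2 (irr_act (2 * m)) I"
      unfolding stable_def
    proof (intro ballI)
      fix s x assume s: "s \<in> carrier (sl2 :: ('k, _) lie_alg)" and x: "x \<in> I"
      then have "irr_act (2 * m) s x = 0" by (simp add: I_def)
      then show "irr_act (2 * m) s x \<in> I" using V.subspace_0[OF \<open>V.subspace I\<close>] by simp
    qed
    moreover have "I \<noteq> coords (2 * m)"
    proof -
      obtain x where x: "x \<in> coords (2 * m)" "irr_act (2 * m) sl2_F x \<noteq> (0 :: nat \<Rightarrow> 'k)"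
        using irr_act_nontrivial[of "2 * m", where ?'k = 'k] m by auto
      then have "x \<notin> I" unfolding I_def using EFH_carrier(2) by blast
      then show ?thesis using x by blast
    qed
    ultimately have "I = {0}"
      using irr_alg_stable_subspace[OF n, of I] by (auto simp: subspace_of_def I_def)
    moreover have "x \<in> I" if "(x, a) \<in> W" for x a
      using stW[OF that] sub that 1 by (auto simp: I_def U_def)
    ultimately have "W \<subseteq> {0} \<times> UNIV" by auto
    then show ?thesis ..
  qed (auto simp: U_def)
qed

text \<open>
  Complete reducibility is immediate once the stable subspaces are known: besides the two trivial
  ones there are just the complement \<open>A\<close> of the centre and the centre \<open>Z\<close>, which are complements of each
  other.
\<close>

lemma lie_s_algebra_heis_alg:
  assumes m: "m \<ge> 1"
  shows "lie_s_algebra sl2 (heis_alg m :: ('k::field_char_0, _, _) lie_s_alg)"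
proof -
  let ?N = "heis_alg m :: ('k, _, _) lie_s_alg"
  let ?n = "2 * m"
  have n: "?n \<ge> 1" using m by simp
  interpret N: sl2_module ?N "act ?N" by unfold_locales (rule lie_module_heis_alg[OF m])
  interpret V: sl2_module "irr_alg ?n :: ('k, _, _) lie_s_alg" "irr_act ?n"
    by unfold_locales (rule lie_module_irr_alg[OF n])
  have actc: "irr_act ?n s x \<in> coords ?n" if "s \<in> carrier sl2" "x \<in> coords ?n" for s :: "'k ^ 2 ^ 2" and x
    using V.act_carrier that by simp
  note hf = heis_form[OF m, where ?'k = 'k]
  have lin: "heis_form m x (y + y') = heis_form m x y + heis_form m x y'"
    "heis_form m (y + y') x = heis_form m y x + heis_form m y' x"
    "heis_form m x (\<lambda>i. c * y i) = c * heis_form m x y"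
    "heis_form m (\<lambda>i. c * y i) x = c * heis_form m y x"
    "heis_form m x x = 0"
    if "x \<in> coords ?n" "y \<in> coords ?n" "y' \<in> coords ?n" for x y y' :: "nat \<Rightarrow> 'k" and c
    using hf that unfolding alternating_form_def linear_between_def by simp_all
  have zc: "(0 :: nat \<Rightarrow> 'k) \<in> coords ?n" by (simp add: coords_def)
  have h0: "heis_form m x 0 = 0" "heis_form m 0 x = 0" if "x \<in> coords ?n" for x :: "nat \<Rightarrow> 'k"
    using lin(3,4)[OF that zc zc, of 0] by (simp_all flip: zero_fun_def)
  have "lie_algebra ?N"
    unfolding lie_algebra_def linear_between_def
    using fin_dim_heis_alg[of m, where ?'k = 'k]
    by (auto simp: heis_alg_simps lin h0 zc zero_prod_def zero_fun_def[symmetric])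
  moreover have "derivation ?N (act ?N s)" if "s \<in> carrier sl2" for s
    unfolding derivation_def
    using N.lin_act[OF that] hf that by (auto simp: heis_alg_simps V.act_zero invariant_form_def zero_prod_def)
  moreover have "completely_reducible sl2 ?N (act ?N)"
    unfolding completely_reducible_def
  proof (intro allI impI)
    fix W assume "subspace_of ?N W \<and> stable sl2 (act ?N) W"
    then have W: "subspace_of ?N W" "stable sl2 (act ?N) W" by auto
    then have sub: "N.subspace W" "W \<subseteq> coords ?n \<times> UNIV" by (auto simp: subspace_of_def heis_alg_simps)
    have W0: "(0, 0) \<in> W" using N.subspace_0[OF sub(1)] by (simp add: zero_prod_def)
    have line: "(0, b) \<in> W" if "(0, a) \<in> W" "a \<noteq> 0" for a b
      using N.subspace_scale[OF sub(1) that(1), of "b / a"] that(2) by (simp add: heis_alg_simps flip: zero_fun_def)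
    define A Z :: "((nat \<Rightarrow> 'k) \<times> 'k) set" where "A = coords ?n \<times> {0 :: 'k}" and "Z = {0 :: nat \<Rightarrow> 'k} \<times> (UNIV :: 'k set)"
    have "N.subspace A"
      by (rule N.subspaceI) (auto simp: A_def heis_alg_simps zero_prod_def coords_closed)
    then have A: "subspace_of ?N A" "stable sl2 (act ?N) A"
      unfolding subspace_of_def stable_def by (auto simp: A_def heis_alg_simps actc)
    have "N.subspace Z"
      by (rule N.subspaceI) (auto simp: Z_def heis_alg_simps zero_prod_def zero_fun_def)
    then have Z: "subspace_of ?N Z" "stable sl2 (act ?N) Z"
      unfolding subspace_of_def stable_def by (auto simp: Z_def heis_alg_simps V.act_zero)
    have "N.subspace {0}" by (rule N.subspaceI) auto
    then have O: "subspace_of ?N {0}" "stable sl2 (act ?N) {0}"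
      unfolding subspace_of_def stable_def by (auto simp: heis_alg_simps zero_prod_def V.act_zero)
    have C: "subspace_of ?N (carrier ?N)" "stable sl2 (act ?N) (carrier ?N)"
      using N.subspace_carrier N.act_carrier by (auto simp: subspace_of_def stable_def)
    consider "W = {0}" | "W = Z" | "W = A" | "W = carrier ?N"
    proof (cases "A \<subseteq> W")
      case True
      show ?thesis
      proof (cases "W \<subseteq> A")
        case False
        then obtain x a where xa: "(x, a) \<in> W" "a \<noteq> 0" using sub by (auto simp: A_def)
        then have "(x, 0) \<in> W" using True sub by (auto simp: A_def)
        then have "(0, a) \<in> W" using N.subspace_diff[OF sub(1) xa(1), of "(x, 0)"] by simp
        then have "(y, b) \<in> W" if "y \<in> coords ?n" for y b
          using N.subspace_add[OF sub(1), of "(y, 0)" "(0, b)"] line[of a b] xa(2) that True by (auto simp: A_def)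
        then have "W = carrier ?N" using sub by (auto simp: heis_alg_simps)
        then show ?thesis using that by blast
      qed (use True that in blast)
    next
      case False
      then have WZ: "W \<subseteq> Z" using heis_alg_stable_subspace[OF m W] by (auto simp: A_def Z_def)
      show ?thesis
      proof (cases "W \<subseteq> {0}")
        case True
        then show ?thesis using that(1) W0 by (auto simp: zero_prod_def)
      next
        case False
        then obtain a where "(0, a) \<in> W" "a \<noteq> 0" using WZ by (auto simp: Z_def zero_prod_def)
        then have "Z \<subseteq> W" using line by (auto simp: Z_def)
        then show ?thesis using WZ that by blast
      qed
    qed
    then show "\<exists>W'. subspace_of ?N W' \<and> stable sl2 (act ?N) W' \<and> W \<inter> W' = {0} \<and>
        {w + w' |w w'. w \<in> W \<and> w' \<in> W'} = carrier ?N"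
    proof cases
      case 1
      have "{0} \<inter> carrier ?N = {0}" using N.carrier_zero by blast
      then show ?thesis unfolding 1 using C zero_sumset(1)[of "carrier ?N"] by blast
    next
      case 2
      have "{w + w' |w w'. w \<in> Z \<and> w' \<in> A} = carrier ?N"
        by (force simp: Z_def A_def heis_alg_simps)
      then show ?thesis using 2 A zc by (intro exI[of _ A]) (auto simp: Z_def A_def zero_prod_def)
    next
      case 3
      have "{w + w' |w w'. w \<in> A \<and> w' \<in> Z} = carrier ?N"
        by (force simp: Z_def A_def heis_alg_simps)
      then show ?thesis using 3 Z zc by (intro exI[of _ Z]) (auto simp: Z_def A_def zero_prod_def)
    next
      case 4
      have "carrier ?N \<inter> {0} = {0}" using N.carrier_zero by blast
      then show ?thesis unfolding 4 using O zero_sumset(2)[of "carrier ?N"] by blast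
    qed
  qed
  ultimately show ?thesis using N.mod unfolding lie_s_algebra_def by blast
qed

lemma minimal_heis_alg:
  assumes m: "m \<ge> 1"
  shows "minimal_lie_s_algebra sl2 (heis_alg m :: ('k::field_char_0, _, _) lie_s_alg)"
proof -
  let ?N = "heis_alg m :: ('k, _, _) lie_s_alg"
  let ?n = "2 * m"
  have n: "?n \<ge> 1" using m by simp
  interpret N: sl2_module ?N "act ?N" by unfold_locales (rule lie_module_heis_alg[OF m])
  interpret V: sl2_module "irr_alg ?n :: ('k, _, _) lie_s_alg" "irr_act ?n"
    by unfold_locales (rule lie_module_irr_alg[OF n])
  note lsa = lie_s_algebra_heis_alg[OF m, where ?'k = 'k]
  obtain x where "x \<in> coords ?n" "irr_act ?n sl2_F x \<noteq> (0 :: nat \<Rightarrow> 'k)"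
    using irr_act_nontrivial[of ?n, where ?'k = 'k] m by auto
  then have "(x, 0) \<in> carrier ?N" "act ?N sl2_F (x, 0) \<noteq> 0" by (simp_all add: heis_alg_simps zero_prod_def)
  then have "act_subalgebra sl2 ?N (carrier ?N) \<noteq> {0}"
    unfolding act_subalgebra_eq_zero_iff[OF lsa order_refl] using EFH_carrier(2) by blast
  moreover have "M = carrier ?N \<or> act_subalgebra sl2 ?N M = {0}"
    if M: "lie_subalgebra ?N M \<and> stable sl2 (act ?N) M" for M
  proof -
    have sub: "subspace_of ?N M" "N.subspace M" "M \<subseteq> carrier ?N"
      using M by (auto simp: lie_subalgebra_def subspace_of_def)
    consider "M \<subseteq> {0} \<times> UNIV" | "coords ?n \<times> {0} \<subseteq> M"
      using heis_alg_stable_subspace[OF m sub(1)] M by blast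
    then show ?thesis
    proof cases
      case 1
      then have "act_subalgebra sl2 ?N M = {0}"
        unfolding act_subalgebra_eq_zero_iff[OF lsa sub(3)]
        by (auto simp: heis_alg_simps V.act_zero zero_prod_def)
      then show ?thesis ..
    next
      case 2
      obtain x y where xy: "x \<in> coords ?n" "y \<in> coords ?n" "heis_form m x y \<noteq> (0 :: 'k)"
        using heis_form[OF m, where ?'k = 'k] by auto
      then have "brk ?N (x, 0) (y, 0) \<in> M"
        using M 2 unfolding lie_subalgebra_def by auto
      then have z: "(0, heis_form m x y) \<in> M" by (simp add: heis_alg_simps)
      have "(v, b) \<in> M" if "v \<in> coords ?n" for v b
      proof -
        have "(0, b) \<in> M"
          using N.subspace_scale[OF sub(2) z, of "b / heis_form m x y"] xy(3)
          by (simp add: heis_alg_simps flip: zero_fun_def)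
        then show ?thesis using N.subspace_add[OF sub(2), of "(v, 0)" "(0, b)"] 2 that by auto
      qed
      then have "M = carrier ?N" using sub by (auto simp: heis_alg_simps)
      then show ?thesis ..
    qed
  qed
  ultimately show ?thesis using lsa unfolding minimal_lie_s_algebra_def by blast
qed

section \<open>Classification\<close>

text \<open>
  A minimal solvable algebra consists of a string together with a central invariant vector \<open>z\<close> that
  controls all brackets. The last conclusion says that the sum of the span of the string and the
  line through \<open>z\<close> is direct, in a form that covers \<open>z = 0\<close> as well.
\<close>

lemma minimal_solvable_structure:
  fixes N :: "('k::field_char_0, 'k ^ 2 ^ 2, 'a::ab_group_add) lie_s_alg"
  assumes min: "minimal_lie_s_algebra sl2 N" and sol: "solvable N"
  obtains n w z where "n \<ge> 2" "hw_string N (act N) n w" "z \<in> carrier N"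
    "\<And>s. s \<in> carrier sl2 \<Longrightarrow> act N s z = 0"
    "\<And>x. brk N (comb N n w x) z = 0" "\<And>x. brk N z (comb N n w x) = 0"
    "\<And>x y. brk N (comb N n w x) (comb N n w y) = scale N (string_form n x y) z"
    "z \<noteq> 0 \<Longrightarrow> even n"
    "\<And>y. y \<in> carrier N \<Longrightarrow> \<exists>x\<in>coords n. \<exists>a. y = comb N n w x + scale N a z"
    "\<And>x a. comb N n w x + scale N a z = 0 \<Longrightarrow> comb N n w x = 0"
proof -
  have lsa: "lie_s_algebra sl2 N" using min by (simp add: minimal_lie_s_algebra_def)
  then have lie: "lie_algebra N" and der: "\<And>s. s \<in> carrier sl2 \<Longrightarrow> derivation N (act N s)"
    and cr: "completely_reducible sl2 N (act N)" by (auto simp: lie_s_algebra_def)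
  interpret sl2_module N "act N" using lsa by unfold_locales (simp add: lie_s_algebra_def)
  have brk1: "linear_between N N (brk N x)" and brk2: "linear_between N N (\<lambda>y. brk N y x)"
    and alt: "brk N x x = 0" if "x \<in> carrier N" for x
    using lie that by (auto simp: lie_algebra_def)
  have brkc [simp]: "brk N x y \<in> carrier N" if "x \<in> carrier N" "y \<in> carrier N" for x y
    using brk1[OF that(1)] that by (simp add: linear_between_def)
  have brk_add: "brk N x (y + y') = brk N x y + brk N x y'" "brk N (y + y') x = brk N y x + brk N y' x"
    if "x \<in> carrier N" "y \<in> carrier N" "y' \<in> carrier N" for x y y'
    using brk1[OF that(1)] brk2[OF that(1)] that(2,3) unfolding linear_between_def by simp_all
  have brk_scale: "brk N x (scale N c y) = scale N c (brk N x y)" "brk N (scale N c y) x = scale N c (brk N y x)"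
    if "x \<in> carrier N" "y \<in> carrier N" for x y c
    using brk1[OF that(1)] brk2[OF that(1)] that(2) unfolding linear_between_def by simp_all
  have anti: "brk N x y = - brk N y x" if "x \<in> carrier N" "y \<in> carrier N" for x y
  proof -
    have "brk N (x + y) (x + y) = brk N x y + brk N y x"
      using that by (simp add: brk_add alt[OF that(1)] alt[OF that(2)])
    moreover have "brk N (x + y) (x + y) = 0" using that by (intro alt) simp
    ultimately have "brk N x y + brk N y x = 0" by (simp only:)
    then show ?thesis unfolding eq_neg_iff_add_eq_0 .
  qed
  have derD: "act N s (brk N x y) = brk N (act N s x) y + brk N x (act N s y)"
    if "s \<in> carrier sl2" "x \<in> carrier N" "y \<in> carrier N" for s x y
    using der[OF that(1)] that by (simp add: derivation_def)
  have "\<not> (\<forall>s\<in>carrier sl2. \<forall>x\<in>carrier N. act N s x = 0)"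
    using min act_subalgebra_eq_zero_iff[OF lsa order_refl] by (simp add: minimal_lie_s_algebra_def)
  then obtain s0 x0 where s0: "s0 \<in> carrier sl2" "x0 \<in> carrier N" "act N s0 x0 \<noteq> 0" by blast
  have triv: "M = carrier N" if "subspace M" "M \<subseteq> carrier N" "\<And>x y. x \<in> M \<Longrightarrow> y \<in> M \<Longrightarrow> brk N x y \<in> M"
    "\<And>s x. s \<in> carrier sl2 \<Longrightarrow> x \<in> M \<Longrightarrow> act N s x \<in> M"
    "s \<in> carrier sl2" "x \<in> M" "act N s x \<noteq> 0" for M s x
  proof -
    have "lie_subalgebra N M \<and> stable sl2 (act N) M"
      using that by (simp add: lie_subalgebra_def subspace_of_def stable_def)
    then have "M = carrier N \<or> act_subalgebra sl2 N M = {0}"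
      using min by (simp add: minimal_lie_s_algebra_def)
    then show ?thesis using act_subalgebra_eq_zero_iff[OF lsa that(2)] that(5-7) by blast
  qed

  \<comment> \<open>The derived subalgebra is proper by solvability, so minimality makes the action on it trivial.\<close>
  define D where "D = derived_series N (Suc 0)"
  have D_span: "D = span {brk N x y |x y. x \<in> carrier N \<and> y \<in> carrier N}"
    by (simp add: D_def)
  have D_sub: "subspace D" unfolding D_span by (rule subspace_span)
  have D_car: "D \<subseteq> carrier N"
    unfolding D_span by (rule span_minimal) (auto simp: subspace_carrier)
  have D_brk: "brk N x y \<in> D" if "x \<in> carrier N" "y \<in> carrier N" for x y
    unfolding D_span using that by (intro span_base) auto
  have D_act: "act N s x \<in> D" if "s \<in> carrier sl2" "x \<in> D" for s x
  proof -
    have "subspace {x \<in> carrier N. act N s x \<in> D}"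
      using D_sub by (intro subspaceI) (auto simp: act_zero act_add act_scale that(1) subspace_0 subspace_add subspace_scale)
    moreover have "act N s (brk N x y) \<in> D" if "x \<in> carrier N" "y \<in> carrier N" for x y
      using that \<open>s \<in> carrier sl2\<close> by (simp add: derD subspace_add[OF D_sub] D_brk act_carrier)
    ultimately have "D \<subseteq> {x \<in> carrier N. act N s x \<in> D}"
      unfolding D_span by (intro span_minimal) (auto simp flip: D_span)
    then show ?thesis using that by blast
  qed
  have "D \<noteq> carrier N"
  proof
    assume D: "D = carrier N"
    have "derived_series N i = carrier N" for i
    proof (induction i)
      case (Suc i)
      then show ?case using D D_span by simp
    qed simp
    then have "carrier N = {0}" using sol by (simp add: solvable_def)
    then show False using s0 act_zero by simp
  qed
  then have D_triv: "act N s x = 0" if "s \<in> carrier sl2" "x \<in> D" for s x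
    using triv[OF D_sub D_car] D_brk D_car D_act that by blast

  \<comment> \<open>A complement of the invariants is nonzero, and a string of length one in it would be invariant.\<close>
  define I where "I = {x \<in> carrier N. \<forall>s\<in>carrier sl2. act N s x = 0}"
  have "subspace_of N I"
    using subspace_invariants unfolding subspace_of_def I_def by blast
  moreover have "stable sl2 (act N) I" by (auto simp: stable_def I_def act_zero)
  ultimately have "\<exists>W. subspace_of N W \<and> stable sl2 (act N) W \<and> I \<inter> W = {0} \<and>
      {x + y |x y. x \<in> I \<and> y \<in> W} = carrier N"
    using cr[unfolded completely_reducible_def, rule_format, of I] by simp
  then obtain W where W: "subspace_of N W" "stable sl2 (act N) W" "I \<inter> W = {0}"
    "{x + y |x y. x \<in> I \<and> y \<in> W} = carrier N"
    by (elim exE conjE)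
  have W_nz: "W \<noteq> {0}"
  proof
    assume "W = {0}"
    then have "carrier N = I" using W(4) by simp
    then show False using s0 by (auto simp: I_def)
  qed
  have W_car: "W \<subseteq> carrier N" using W by (simp add: subspace_of_def)
  let ?W = "N\<lparr>carrier := W\<rparr>"
  interpret W: sl2_module ?W "act N"
    by unfold_locales (rule lie_module_submodule[OF mod W(1,2)])
  obtain n w where n: "n \<ge> 1" and wW: "hw_string ?W (act N) n w"
    using W.exists_hw_string W_nz by auto
  have w: "hw_string N (act N) n w" using wW W_car by (auto simp: hw_string_def)
  have wz: "w i = 0 \<longleftrightarrow> n \<le> i" and wE: "E (w i) = scale N (of_nat i * (of_nat n - of_nat i)) (w (i - 1))"
    and wF: "F (w i) = w (Suc i)" and wH: "H (w i) = scale N (of_nat n - 1 - 2 * of_nat i) (w i)" for i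
    using w unfolding hw_string_def by blast+
  have w_W: "w i \<in> W" for i using wW by (simp add: hw_string_def)
  note wc = hw_string_carrier[OF w]
  have comb_W: "comb N n w x \<in> W" for x
    using W.comb_carrier[OF wW, of x] by (simp add: comb_def)
  have "n \<noteq> 1"
  proof
    assume n1: "n = 1"
    have "w 1 = 0" using wz[of 1] n1 by simp
    then have "act N s (w 0) = 0" if "s \<in> carrier sl2" for s
      using act_decompose[OF that wc, of 0] wE[of 0] wF[of 0] wH[of 0] n1 by simp
    then have "w 0 \<in> I \<inter> W" using w_W wc by (simp add: I_def)
    then show False using W(3) wz[of 0] n1 by auto
  qed
  then have n2: "n \<ge> 2" using n by simp
  define U where "U = comb N n w ` coords n"
  have U_sub: "subspace U" unfolding U_def by (rule comb_image_subspace[OF w])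
  have U_car: "U \<subseteq> carrier N" unfolding U_def using comb_carrier[OF w] by auto
  have U_act: "act N s x \<in> U" if "s \<in> carrier sl2" "x \<in> U" for s x
    using comb_image_stable[OF w] that unfolding U_def stable_def by blast
  have w_U: "w i \<in> U" for i
  proof (cases "i < n")
    case True
    then show ?thesis unfolding U_def using comb_unit_vec unit_vec_coords by (metis imageI)
  next
    case False
    then show ?thesis using wz[of i] subspace_0[OF U_sub] by simp
  qed
  have w1: "act N sl2_F (w 0) \<noteq> 0" using wF[of 0] wz[of 1] n2 by simp

  \<comment> \<open>Each vector of the string is a multiple of some \<open>[s, w j]\<close>: the first one because of \<open>E (w 1)\<close>,
    whose coefficient \<open>n - 1\<close> is nonzero, and the others because of \<open>F\<close>.\<close>
  have central: "brk N d (w i) = 0" if d: "d \<in> D" for d i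
  proof -
    have dc: "d \<in> carrier N" using d D_car by blast
    have *: "brk N d (act N s (w j)) = 0" if s: "s \<in> carrier sl2" for s j
    proof -
      have "act N s (brk N d (w j)) = 0" using D_triv[OF s] D_brk[OF dc wc] by blast
      moreover have "act N s d = 0" using D_triv[OF s d] .
      moreover have "brk N 0 (w j) = 0" using brk_scale(2)[OF wc[of j] carrier_zero, of 0] by simp
      ultimately show ?thesis using derD[OF s dc wc[of j]] by simp
    qed
    show ?thesis
    proof (cases i)
      case 0
      have "w 0 = scale N (inverse (of_nat n - 1)) (E (w 1))"
        using wE[of 1] n2 by simp
      then show ?thesis using 0 *[of sl2_E 1] brk_scale(1)[OF dc E.T_carrier[OF wc]] by simp
    next
      case (Suc j)
      then show ?thesis using *[of sl2_F j] wF by simp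
    qed
  qed
  have central_comb: "brk N d (comb N n w x) = 0" if d: "d \<in> D" for d x
  proof -
    have "brk N d (comb N n w x) = comb N n (\<lambda>i. brk N d (w i)) x"
      using D_car d by (intro linear_between_comb[OF fin_dim fin_dim brk1] wc) auto
    then show ?thesis using central[OF d] by (simp add: comb_def)
  qed
  define z where "z = brk N (w 0) (w (n - 1))"
  have zD: "z \<in> D" unfolding z_def by (intro D_brk wc)
  then have zc: "z \<in> carrier N" using D_car by blast
  have inv: "brk N (act N s x) y + brk N x (act N s y) = 0"
    if "s \<in> carrier sl2" "x \<in> carrier N" "y \<in> carrier N" for s x y
    using derD[OF that] D_triv[OF that(1) D_brk[OF that(2,3)]] by simp
  have form: "brk N (comb N n w x) (comb N n w y) = scale N (string_form n x y) z" for x y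
    unfolding z_def by (rule invariant_form_eq_string_form[OF w fin_dim brk1 brk2 inv])
  have zcomb: "brk N z (comb N n w x) = 0" "brk N (comb N n w x) z = 0" for x
    using central_comb[OF zD] anti[OF comb_carrier[OF w] zc] by simp_all

  \<comment> \<open>The span of \<open>U\<close> and \<open>z\<close> is a subalgebra since \<open>[U, U]\<close> lies in the line of \<open>z\<close> and \<open>z\<close> commutes with \<open>U\<close>.\<close>
  define M where "M = {u + scale N a z |u a. u \<in> U}"
  have "M = carrier N"
  proof (rule triv)
    show "subspace M"
    proof (rule subspaceI)
      show "0 \<in> M" unfolding M_def using subspace_0[OF U_sub] by (force intro: exI[of _ 0])
    next
      fix x y assume "x \<in> M" "y \<in> M"
      then obtain u a v b where "x = u + scale N a z" "u \<in> U" "y = v + scale N b z" "v \<in> U"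
        unfolding M_def by blast
      then show "x + y \<in> M" unfolding M_def
        by (auto intro!: exI[of _ "u + v"] exI[of _ "a + b"] simp: scale_left_distrib subspace_add[OF U_sub])
    next
      fix c x assume "x \<in> M"
      then obtain u a where "x = u + scale N a z" "u \<in> U" unfolding M_def by blast
      then show "scale N c x \<in> M" unfolding M_def
        by (auto intro!: exI[of _ "scale N c u"] exI[of _ "c * a"] simp: scale_right_distrib subspace_scale[OF U_sub])
    qed
    show "M \<subseteq> carrier N" unfolding M_def using U_car zc by auto
    show "brk N x y \<in> M" if xyM: "x \<in> M" "y \<in> M" for x y
    proof -
      obtain p a q b where xy: "x = comb N n w p + scale N a z" "y = comb N n w q + scale N b z"
        using xyM unfolding M_def U_def by blast
      have "brk N x y = 0 + scale N (string_form n p q) z"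
        unfolding xy using zc comb_carrier[OF w]
        by (simp add: brk_add brk_scale form zcomb alt)
      then show ?thesis unfolding M_def using subspace_0[OF U_sub] by blast
    qed
    show "act N s x \<in> M" if s: "s \<in> carrier sl2" and xM: "x \<in> M" for s x
    proof -
      obtain u a where x: "x = u + scale N a z" "u \<in> U" using xM unfolding M_def by blast
      then have "act N s x = act N s u + scale N 0 z"
        using s U_car zc D_triv[OF s zD] by (auto simp: act_add act_scale)
      then show ?thesis unfolding M_def using U_act[OF s x(2)] by blast
    qed
    show "w 0 \<in> M" unfolding M_def using w_U[of 0] by (force intro: exI[of _ 0])
  qed (rule EFH_carrier w1)+
  show thesis
  proof (rule that[OF n2 w zc _ zcomb(2,1) form])
    show "act N s z = 0" if "s \<in> carrier sl2" for s using D_triv[OF that zD] .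
    show "even n" if "z \<noteq> 0"
      using that even_if_invariant_form_alternating[OF w fin_dim brk1 brk2 inv n] anti
      unfolding z_def by blast
    show "\<exists>x\<in>coords n. \<exists>a. y = comb N n w x + scale N a z" if "y \<in> carrier N" for y
      using that \<open>M = carrier N\<close> unfolding M_def U_def by blast
    show "comb N n w x = 0" if "comb N n w x + scale N a z = 0" for x a
    proof -
      have "comb N n w x = scale N (- a) z" using that by (simp add: add_eq_0_iff2)
      also have "\<dots> \<in> I" using zc D_triv[OF _ zD] by (simp add: I_def act_scale del: scale_minus_left)
      finally show ?thesis using comb_W W(3) by blast
    qed
  qed
qed

text \<open>
  Two algebras parametrised bijectively by the same set \<open>P\<close> are isomorphic as soon as the operations
  correspond to each other on parameters. This avoids computing with the inverse of a
  parametrisation.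
\<close>

lemma lie_s_isomorphic_by_parametrisation:
  assumes p: "bij_betw p P (carrier N)" and q: "bij_betw q P (carrier N')"
    and add: "\<And>a b. a \<in> P \<Longrightarrow> b \<in> P \<Longrightarrow> \<exists>c\<in>P. p c = p a + p b \<and> q c = q a + q b"
    and scale: "\<And>k a. a \<in> P \<Longrightarrow> \<exists>c\<in>P. p c = scale N k (p a) \<and> q c = scale N' k (q a)"
    and brk: "\<And>a b. a \<in> P \<Longrightarrow> b \<in> P \<Longrightarrow> \<exists>c\<in>P. p c = brk N (p a) (p b) \<and> q c = brk N' (q a) (q b)"
    and act: "\<And>s a. s \<in> carrier S \<Longrightarrow> a \<in> P \<Longrightarrow> \<exists>c\<in>P. p c = act N s (p a) \<and> q c = act N' s (q a)"
  shows "lie_s_isomorphic S N N'"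
proof -
  define f where "f = q \<circ> inv_into P p"
  have fp: "f (p a) = q a" if "a \<in> P" for a
    using that p by (simp add: f_def bij_betw_def)
  have ex: "\<exists>a\<in>P. x = p a" if "x \<in> carrier N" for x
    using that p by (auto simp: bij_betw_def)
  have qc: "q a \<in> carrier N'" if "a \<in> P" for a
    using that q by (auto simp: bij_betw_def)
  have bij: "bij_betw f (carrier N) (carrier N')"
    unfolding f_def by (rule bij_betw_trans[OF bij_betw_inv_into[OF p] q])
  show ?thesis
    unfolding lie_s_isomorphic_def linear_between_def
  proof (intro exI[of _ f] conjI ballI allI bij)
    fix x assume "x \<in> carrier N"
    then obtain a where a: "a \<in> P" "x = p a" using ex by blast
    show "f x \<in> carrier N'" using a fp qc by simp
    show "f (scale N k x) = scale N' k (f x)" for k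
      using scale[OF a(1), of k] a fp by metis
    show "f (act N s x) = act N' s (f x)" if "s \<in> carrier S" for s
      using act[OF that a(1)] a fp by metis
    fix y assume "y \<in> carrier N"
    then obtain b where b: "b \<in> P" "y = p b" using ex by blast
    show "f (x + y) = f x + f y" using add[OF a(1) b(1)] a b fp by metis
    show "f (brk N x y) = brk N' (f x) (f y)" using brk[OF a(1) b(1)] a b fp by metis
  qed
qed

text \<open>
  Coordinates with respect to the string (and the vector \<open>z\<close>) parametrise both the given algebra and
  its model. In the Heisenberg case the value \<open>c\<close> of the chosen form on the ends of the string
  need not be one, so the central coordinate is rescaled by \<open>c\<close>.
\<close>

lemma minimal_solvable_classification:
  fixes N :: "('k::field_char_0, 'k ^ 2 ^ 2, 'a::ab_group_add) lie_s_alg"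
  assumes min: "minimal_lie_s_algebra sl2 N" and sol: "solvable N"
  shows "\<exists>n\<ge>2. lie_s_isomorphic sl2 N (irr_alg n) \<or> lie_s_isomorphic sl2 N (heis_alg (n - 1))"
proof (rule minimal_solvable_structure[OF min sol])
  fix n w z
  assume n: "n \<ge> 2" and w: "hw_string N (act N) n w" and zc: "z \<in> carrier N"
    and actz: "\<And>s. s \<in> carrier sl2 \<Longrightarrow> act N s z = 0"
    and wz: "\<And>x. brk N (comb N n w x) z = 0" "\<And>x. brk N z (comb N n w x) = 0"
    and form: "\<And>x y. brk N (comb N n w x) (comb N n w y) = scale N (string_form n x y) z"
    and ev: "z \<noteq> 0 \<Longrightarrow> even n"
    and spn: "\<And>y. y \<in> carrier N \<Longrightarrow> \<exists>x\<in>coords n. \<exists>a. y = comb N n w x + scale N a z"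
    and dir: "\<And>x a. comb N n w x + scale N a z = 0 \<Longrightarrow> comb N n w x = 0"
  have lsa: "lie_s_algebra sl2 N" using min by (simp add: minimal_lie_s_algebra_def)
  then have lie: "lie_algebra N" by (simp add: lie_s_algebra_def)
  interpret N: sl2_module N "act N" using lsa by unfold_locales (simp add: lie_s_algebra_def)
  let ?V = "irr_alg n :: ('k, _, _) lie_s_alg"
  have n1: "n \<ge> 1" using n by simp
  interpret V: sl2_module ?V "irr_act n" by unfold_locales (rule lie_module_irr_alg[OF n1])
  obtain u where u: "hw_string ?V (irr_act n) n u" and surj: "comb ?V n u ` coords n = coords n"
    using irr_alg_hw_string[OF n1] by blast
  have u_inj: "inj_on (comb ?V n u) (coords n)" using V.comb_inj[OF u] by (auto intro: inj_onI)
  note wc = N.comb_carrier[OF w]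
  show ?thesis
  proof (cases "z = 0")
    case True
    have "lie_s_isomorphic sl2 N ?V"
    proof (rule lie_s_isomorphic_by_parametrisation[of "comb N n w" "coords n" _ "comb ?V n u"])
      show "bij_betw (comb N n w) (coords n) (carrier N)"
        unfolding bij_betw_def using N.comb_inj[OF w] wc spn True by (auto intro!: inj_onI) force
      show "bij_betw (comb ?V n u) (coords n) (carrier ?V)"
        using u_inj surj by (simp add: bij_betw_def)
    next
      fix a b :: "nat \<Rightarrow> 'k" assume ab: "a \<in> coords n" "b \<in> coords n"
      then show "\<exists>c\<in>coords n. comb N n w c = comb N n w a + comb N n w b \<and>
          comb ?V n u c = comb ?V n u a + comb ?V n u b"
        using coords_closed(1) N.comb_add V.comb_add by blast
      have "comb N n w 0 = 0" "comb ?V n u 0 = 0"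
        using N.comb_scale[of n w 0 0] V.comb_scale[of n u 0 0]
        by (simp_all add: zero_fun_def)
      then show "\<exists>c\<in>coords n. comb N n w c = brk N (comb N n w a) (comb N n w b) \<and>
          comb ?V n u c = brk ?V (comb ?V n u a) (comb ?V n u b)"
        by (intro bexI[of _ 0]) (simp_all add: form True)
    next
      fix k and a :: "nat \<Rightarrow> 'k" assume "a \<in> coords n"
      then show "\<exists>c\<in>coords n. comb N n w c = scale N k (comb N n w a) \<and>
          comb ?V n u c = scale ?V k (comb ?V n u a)"
        using coords_closed(2) N.comb_scale V.comb_scale by blast
    next
      fix s :: "'k ^ 2 ^ 2" and a :: "nat \<Rightarrow> 'k" assume "s \<in> carrier sl2" "a \<in> coords n"
      then show "\<exists>c\<in>coords n. comb N n w c = act N s (comb N n w a) \<and>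
          comb ?V n u c = act ?V s (comb ?V n u a)"
        using str_act_coords N.act_comb[OF w] V.act_comb[OF u]
        by (intro bexI[of _ "str_act n s a"]) simp_all
    qed
    then show ?thesis using n by blast
  next
    case False
    then obtain m where m: "n = 2 * m" using ev by blast
    have m1: "m \<ge> 1" using m n by simp
    let ?H = "heis_alg m :: ('k, _, _) lie_s_alg"
    define c where "c = heis_form m (u 0) (u (n - 1))"
    have c: "c \<noteq> 0" and hf: "heis_form m (comb ?V n u x) (comb ?V n u y) = string_form n x y * c" for x y
      unfolding c_def using heis_form_on_string[OF m1, folded m, OF u surj] by auto
    define p where "p = (\<lambda>(x, a). comb N n w x + scale N a z)"
    define q where "q = (\<lambda>(x, a). (comb ?V n u x, a * c))"
    have uc: "comb ?V n u x \<in> coords n" for x using V.comb_carrier[OF u, of x] by simp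
    have combz: "comb N n w 0 = 0" "comb ?V n u 0 = 0"
      using N.comb_scale[of n w 0 0] V.comb_scale[of n u 0 0]
      by (simp_all add: zero_fun_def)
    have Hs: "carrier ?H = coords n \<times> UNIV" "scale ?H = (\<lambda>c p. (scale ?V c (fst p), c * snd p))"
      "brk ?H = (\<lambda>p q. (0, heis_form m (fst p) (fst q)))"
      "act ?H = (\<lambda>s p. (irr_act n s (fst p), 0))"
      by (simp_all add: heis_alg_simps m)
    have "lie_s_isomorphic sl2 N ?H"
    proof (rule lie_s_isomorphic_by_parametrisation[of p "coords n \<times> UNIV" _ q])
      show "bij_betw p (coords n \<times> UNIV) (carrier N)"
        unfolding bij_betw_def
      proof
        show "inj_on p (coords n \<times> UNIV)"
        proof (rule inj_onI, clarify)
          fix x a y b assume xy: "x \<in> coords n" "y \<in> coords n" and eq: "p (x, a) = p (y, b)"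
          have sum0: "comb N n w (x + (\<lambda>i. (- 1) * y i)) + scale N (a - b) z = 0"
            using eq unfolding N.comb_add N.comb_scale
            by (simp add: p_def N.scale_left_diff_distrib algebra_simps)
          then have "comb N n w (x + (\<lambda>i. (- 1) * y i)) = 0" by (rule dir)
          moreover from this have "scale N (a - b) z = 0" using sum0 by simp
          ultimately have "comb N n w x = comb N n w y" "a = b"
            unfolding N.comb_add N.comb_scale using False by auto
          then show "x = y \<and> a = b" using N.comb_inj[OF w] xy by blast
        qed
        show "p ` (coords n \<times> UNIV) = carrier N"
        proof
          show "p ` (coords n \<times> UNIV) \<subseteq> carrier N" using wc zc by (auto simp: p_def)
          show "carrier N \<subseteq> p ` (coords n \<times> UNIV)"
          proof
            fix y assume "y \<in> carrier N"
            from spn[OF this] obtain x a where "x \<in> coords n" "y = p (x, a)"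
              unfolding p_def by auto
            then show "y \<in> p ` (coords n \<times> UNIV)" by blast
          qed
        qed
      qed
      show "bij_betw q (coords n \<times> UNIV) (carrier ?H)"
        unfolding bij_betw_def Hs
      proof
        show "inj_on q (coords n \<times> UNIV)"
          using V.comb_inj[OF u] c by (auto intro!: inj_onI simp: q_def)
        show "q ` (coords n \<times> UNIV) = coords n \<times> UNIV"
        proof
          show "q ` (coords n \<times> UNIV) \<subseteq> coords n \<times> UNIV" using uc by (auto simp: q_def)
          show "coords n \<times> UNIV \<subseteq> q ` (coords n \<times> UNIV)"
          proof clarify
            fix y :: "nat \<Rightarrow> 'k" and b :: 'k assume "y \<in> coords n"
            then obtain x where "x \<in> coords n" "y = comb ?V n u x" using surj by blast
            then show "(y, b) \<in> q ` (coords n \<times> UNIV)"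
              using c by (intro image_eqI[of _ _ "(x, b / c)"]) (auto simp: q_def)
          qed
        qed
      qed
    next
      fix a b :: "(nat \<Rightarrow> 'k) \<times> 'k" assume ab: "a \<in> coords n \<times> (UNIV :: 'k set)" "b \<in> coords n \<times> (UNIV :: 'k set)"
      obtain x \<alpha> y \<beta> where a: "a = (x, \<alpha>)" and b: "b = (y, \<beta>)" by fastforce
      show "\<exists>c\<in>coords n \<times> UNIV. p c = p a + p b \<and> q c = q a + q b"
        using ab unfolding a b
        by (intro bexI[of _ "(x + y, \<alpha> + \<beta>)"])
           (auto simp: p_def q_def N.comb_add V.comb_add coords_closed
              N.scale_left_distrib algebra_simps)
      have lin: "linear_between N N (brk N v)" "linear_between N N (\<lambda>y. brk N y v)" "brk N v v = 0"
        if "v \<in> carrier N" for v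
        using lie that by (auto simp: lie_algebra_def)
      have "brk N (p a) (p b) = scale N (string_form n x y) z"
        using lin[OF wc[of x]] lin[OF zc] lin[OF N.carrier_add[OF wc[of y] N.carrier_scale[OF zc, of \<beta>]]] wc zc
        unfolding linear_between_def p_def a b by (simp add: form wz)
      then show "\<exists>c\<in>coords n \<times> UNIV. p c = brk N (p a) (p b) \<and> q c = brk ?H (q a) (q b)"
        unfolding a b by (intro bexI[of _ "(0, string_form n x y)"]) (auto simp: p_def q_def combz Hs hf)
    next
      fix k and a :: "(nat \<Rightarrow> 'k) \<times> 'k" assume a': "a \<in> coords n \<times> (UNIV :: 'k set)"
      obtain x \<alpha> where a: "a = (x, \<alpha>)" by fastforce
      show "\<exists>c\<in>coords n \<times> UNIV. p c = scale N k (p a) \<and> q c = scale ?H k (q a)"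
        using a' unfolding a Hs
        by (intro bexI[of _ "((\<lambda>i. k * x i), k * \<alpha>)"])
           (simp_all add: p_def q_def N.comb_scale V.comb_scale
              coords_closed N.scale_right_distrib del: irr_alg_simps)
    next
      fix s :: "'k ^ 2 ^ 2" and a :: "(nat \<Rightarrow> 'k) \<times> 'k" assume s: "s \<in> carrier sl2" and a': "a \<in> coords n \<times> (UNIV :: 'k set)"
      obtain x \<alpha> where a: "a = (x, \<alpha>)" by fastforce
      have "act N s (p a) = comb N n w (str_act n s x)"
        using N.lin_act[OF s] wc zc actz[OF s] N.act_comb[OF w s]
        unfolding linear_between_def p_def a by simp
      then show "\<exists>c\<in>coords n \<times> UNIV. p c = act N s (p a) \<and> q c = act ?H s (q a)"
        using a' s unfolding a Hs
        by (intro bexI[of _ "(str_act n s x, 0)"])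
           (simp_all add: p_def q_def V.act_comb[OF u] str_act_coords)
    qed
    then show ?thesis using m1 by (intro exI[of _ "m + 1"]) simp
  qed
qed

theorem proposition1p7:
  shows "(\<forall>n\<ge>2. minimal_lie_s_algebra sl2
                   (irr_alg n :: ('k::field_char_0, 'k ^ 2 ^ 2, nat \<Rightarrow> 'k) lie_s_alg) \<and>
                 solvable (irr_alg n :: ('k, 'k ^ 2 ^ 2, nat \<Rightarrow> 'k) lie_s_alg)) \<and>
         (\<forall>n\<ge>2. minimal_lie_s_algebra sl2
                   (heis_alg (n - 1) :: ('k, 'k ^ 2 ^ 2, (nat \<Rightarrow> 'k) \<times> 'k) lie_s_alg) \<and>
                 solvable (heis_alg (n - 1) :: ('k, 'k ^ 2 ^ 2, (nat \<Rightarrow> 'k) \<times> 'k) lie_s_alg)) \<and>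
         (\<forall>N :: ('k, 'k ^ 2 ^ 2, 'a::ab_group_add) lie_s_alg.
            minimal_lie_s_algebra sl2 N \<and> solvable N \<longrightarrow>
            (\<exists>n\<ge>2. lie_s_isomorphic sl2 N (irr_alg n) \<or>
                   lie_s_isomorphic sl2 N (heis_alg (n - 1))))"
proof (intro conjI allI impI)
  fix n :: nat assume n: "2 \<le> n"
  then have n1: "1 \<le> n - 1" by simp
  show "minimal_lie_s_algebra sl2 (irr_alg n :: ('k, 'k ^ 2 ^ 2, nat \<Rightarrow> 'k) lie_s_alg)"
    "solvable (irr_alg n :: ('k, 'k ^ 2 ^ 2, nat \<Rightarrow> 'k) lie_s_alg)"
    by (rule minimal_irr_alg[OF n] solvable_irr_alg)+
  show "minimal_lie_s_algebra sl2 (heis_alg (n - 1) :: ('k, 'k ^ 2 ^ 2, (nat \<Rightarrow> 'k) \<times> 'k) lie_s_alg)"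
    "solvable (heis_alg (n - 1) :: ('k, 'k ^ 2 ^ 2, (nat \<Rightarrow> 'k) \<times> 'k) lie_s_alg)"
    by (rule minimal_heis_alg[OF n1] solvable_heis_alg[OF n1])+
next
  fix N :: "('k, 'k ^ 2 ^ 2, 'a) lie_s_alg"
  assume "minimal_lie_s_algebra sl2 N \<and> solvable N"
  then show "\<exists>n\<ge>2. lie_s_isomorphic sl2 N (irr_alg n) \<or> lie_s_isomorphic sl2 N (heis_alg (n - 1))"
    using minimal_solvable_classification by blast
qed

end
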